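(* Let $Q$ be an algebraic group with Lie algebra $\mathfrak q$, and let $V$ be a $Q$-module having GIB such that $\mathrm{ind}(\mathfrak q,V^* )=\dim V-\dim\mathfrak q$. Then for any $Q$-module $W$, the representation $(Q:W\oplus V)$ has GIB and $\mathrm{ind}(\mathfrak q,V^*\oplus W^* )=\dim V+\dim W-\dim\mathfrak q$.
   Context: The ground field $\Bbbk$ is algebraically closed of characteristic zero; $Q$-modules are finite-dimensional and rational. For a Lie algebra $\mathfrak q$ and a finite-dimensional $\mathfrak q$-module $U$, the index is $\mathrm{ind}(\mathfrak q,U)=\dim U-\max_{\xi\in U^*}\dim(\mathfrak q\cdot\xi)$. For $v\in U$, $\mathfrak q_v$ is the stabiliser of $v$ in $\mathfrak q$, and $U/\mathfrak q\cdot v$ is a $\mathfrak q_v$-module. A representation $(Q:U)$ has good index behaviour (GIB) if $\mathrm{ind}(\mathfrak q,U^* )=\mathrm{ind}(\mathfrak q_v,(U/\mathfrak q\cdot v)^* )$ for every $v\in U$. *)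

theory Defs
  imports
    "Jordan_Normal_Form.Missing_VectorSpace"
    "HOL-Algebra.Algebraic_Closure"
    "HOL-Algebra.Group_Action"
    "HOL-Algebra.Generated_Rings"
begin

section \<open>Linear algebra\<close>

definition base_module :: "('k, 'a) ring_scheme \<Rightarrow> ('k, 'k) module" where
  "base_module K = \<lparr>carrier = carrier K, monoid.mult = (\<otimes>\<^bsub>K\<^esub>), one = \<one>\<^bsub>K\<^esub>, zero = \<zero>\<^bsub>K\<^esub>,
     add = add K, smult = (\<otimes>\<^bsub>K\<^esub>)\<rparr>"

definition dual :: "('k, 'a) ring_scheme \<Rightarrow> ('k, 'v, 'b) module_scheme \<Rightarrow> ('k, 'v \<Rightarrow> 'k) module" where
  "dual K V = (ring.func_space K (carrier V))
     \<lparr>carrier := LinearCombinations.module_hom K V (base_module K) \<inter> extensional (carrier V)\<rparr>"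

text \<open>As for \<^const>\<open>FactRing\<close>, the operations on cosets are unions over representatives. The
  multiplicative fields of the record are irrelevant.\<close>

definition quotient_module :: "('k, 'v, 'b) module_scheme \<Rightarrow> 'v set \<Rightarrow> ('k, 'v set) module" where
  "quotient_module V N = \<lparr>carrier = a_rcosets\<^bsub>V\<^esub> N, monoid.mult = (\<lambda>_ _. N), one = N, zero = N,
     add = set_add V, smult = (\<lambda>c C. \<Union>v\<in>C. N +>\<^bsub>V\<^esub> (c \<odot>\<^bsub>V\<^esub> v))\<rparr>"


section \<open>Modules over a Lie algebra and the index\<close>

text \<open>A Lie algebra is given by a \<^typ>\<open>('k, 'x) module\<close> record whose field \<^const>\<open>monoid.mult\<close> is
  the bracket; a module \<open>U\<close> over it comes with an action map of type \<open>'x \<Rightarrow> 'v \<Rightarrow> 'v\<close>.\<close>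

definition orbit_space ::
  "('k, 'x, 'c) module_scheme \<Rightarrow> ('x \<Rightarrow> 'v \<Rightarrow> 'v) \<Rightarrow> 'v \<Rightarrow> 'v set" where
  "orbit_space L act v = (\<lambda>x. act x v) ` carrier L"

definition dual_act ::
  "('k, 'a) ring_scheme \<Rightarrow> ('k, 'v, 'b) module_scheme \<Rightarrow> ('x \<Rightarrow> 'v \<Rightarrow> 'v) \<Rightarrow>
     'x \<Rightarrow> ('v \<Rightarrow> 'k) \<Rightarrow> ('v \<Rightarrow> 'k)" where
  "dual_act K U act x \<xi> = (\<lambda>u\<in>carrier U. \<ominus>\<^bsub>K\<^esub> \<xi> (act x u))"

definition quotient_act ::
  "('k, 'v, 'b) module_scheme \<Rightarrow> 'v set \<Rightarrow> ('x \<Rightarrow> 'v \<Rightarrow> 'v) \<Rightarrow> 'x \<Rightarrow> 'v set \<Rightarrow> 'v set" where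
  "quotient_act U N act x C = (\<Union>u\<in>C. N +>\<^bsub>U\<^esub> act x u)"

text \<open>The action on a direct sum, for the action of a Lie algebra as well as of a group.\<close>

definition direct_sum_act ::
  "('k, 'v, 'b) module_scheme \<Rightarrow> ('k, 'w, 'c) module_scheme \<Rightarrow> ('x \<Rightarrow> 'v \<Rightarrow> 'v) \<Rightarrow>
     ('x \<Rightarrow> 'w \<Rightarrow> 'w) \<Rightarrow> 'x \<Rightarrow> 'v \<times> 'w \<Rightarrow> 'v \<times> 'w" where
  "direct_sum_act V W act act' x = (\<lambda>(v, w)\<in>carrier V \<times> carrier W. (act x v, act' x w))"

definition stabiliser ::
  "('k, 'x, 'c) module_scheme \<Rightarrow> ('k, 'v, 'b) module_scheme \<Rightarrow> ('x \<Rightarrow> 'v \<Rightarrow> 'v) \<Rightarrow> 'v \<Rightarrow>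
     ('k, 'x, 'c) module_scheme" where
  "stabiliser L U act v = L\<lparr>carrier := {x \<in> carrier L. act x v = \<zero>\<^bsub>U\<^esub>}\<rparr>"

definition lie_index ::
  "('k, 'a) ring_scheme \<Rightarrow> ('k, 'x, 'c) module_scheme \<Rightarrow> ('k, 'v, 'b) module_scheme \<Rightarrow>
     ('x \<Rightarrow> 'v \<Rightarrow> 'v) \<Rightarrow> int" where
  "lie_index K L U act = int (vectorspace.dim K U) -
     int (Max ((\<lambda>\<xi>. vectorspace.dim K
                   ((dual K U)\<lparr>carrier := orbit_space L (dual_act K U act) \<xi>\<rparr>))
               ` carrier (dual K U)))"

definition lie_good_index_behaviour ::
  "('k, 'a) ring_scheme \<Rightarrow> ('k, 'x, 'c) module_scheme \<Rightarrow> ('k, 'v, 'b) module_scheme \<Rightarrow>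
     ('x \<Rightarrow> 'v \<Rightarrow> 'v) \<Rightarrow> bool" where
  "lie_good_index_behaviour K L U act \<longleftrightarrow>
     (\<forall>v\<in>carrier U.
        let N = orbit_space L act v; U' = quotient_module U N
        in lie_index K L (dual K U) (dual_act K U act) =
           lie_index K (stabiliser L U act v) (dual K U') (dual_act K U' (quotient_act U N act)))"


section \<open>Affine varieties and algebraic groups\<close>

definition function_algebra :: "('k, 'a) ring_scheme \<Rightarrow> 'p set \<Rightarrow> ('k, 'p \<Rightarrow> 'k) module" where
  "function_algebra K P = (ring.func_space K P)
     \<lparr>monoid.mult := (\<lambda>f g. \<lambda>x\<in>P. f x \<otimes>\<^bsub>K\<^esub> g x), one := (\<lambda>x\<in>P. \<one>\<^bsub>K\<^esub>)\<rparr>"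

definition constant_functions :: "('k, 'a) ring_scheme \<Rightarrow> 'p set \<Rightarrow> ('p \<Rightarrow> 'k) set" where
  "constant_functions K P = (\<lambda>c. \<lambda>x\<in>P. c) ` carrier K"

text \<open>An affine variety over an algebraically closed field, given intrinsically by its point set
  \<open>P\<close> and its coordinate ring \<open>A\<close>: a finitely generated \<open>K\<close>-algebra of functions on \<open>P\<close> such
  that the \<open>K\<close>-algebra homomorphisms \<open>A \<rightarrow> K\<close> are exactly the evaluations at the points of
  \<open>P\<close>, different points giving different evaluations.\<close>

locale affine_variety = K: field K
  for K :: "('k, 'a) ring_scheme" and P :: "'p set" and A :: "('p \<Rightarrow> 'k) set" +
  assumes finitely_generated:
      "\<exists>F. finite F \<and> F \<subseteq> carrier (function_algebra K P) \<and>
           A = generate_ring (function_algebra K P) (constant_functions K P \<union> F)"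
    and points:
      "\<lbrakk>\<phi> \<in> ring_hom ((function_algebra K P)\<lparr>carrier := A\<rparr>) K;
        \<And>c. c \<in> carrier K \<Longrightarrow> \<phi> (\<lambda>x\<in>P. c) = c\<rbrakk> \<Longrightarrow> \<exists>!x. x \<in> P \<and> (\<forall>f\<in>A. \<phi> f = f x)"

definition regular_maps ::
  "'p set \<Rightarrow> ('p \<Rightarrow> 'k) set \<Rightarrow> 'q set \<Rightarrow> ('q \<Rightarrow> 'k) set \<Rightarrow> ('p \<Rightarrow> 'q) set" where
  "regular_maps P A P' B = {\<phi> \<in> P \<rightarrow> P'. \<forall>f\<in>B. (\<lambda>x\<in>P. f (\<phi> x)) \<in> A}"

text \<open>The coordinate ring of \<open>P \<times> P'\<close>, i.e. the image of \<open>A \<otimes> B\<close> in the functions on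
  \<open>P \<times> P'\<close>.\<close>

definition product_coordinate_ring ::
  "('k, 'a) ring_scheme \<Rightarrow> 'p set \<Rightarrow> ('p \<Rightarrow> 'k) set \<Rightarrow> 'q set \<Rightarrow> ('q \<Rightarrow> 'k) set \<Rightarrow>
     ('p \<times> 'q \<Rightarrow> 'k) set" where
  "product_coordinate_ring K P A P' B = generate_ring (function_algebra K (P \<times> P'))
     ((\<lambda>f. \<lambda>(x, y)\<in>P \<times> P'. f x) ` A \<union> (\<lambda>g. \<lambda>(x, y)\<in>P \<times> P'. g y) ` B)"

text \<open>Algebraic groups are affine.\<close>

locale algebraic_group = affine_variety K "carrier Q" A + Q: group Q
  for K :: "('k, 'a) ring_scheme" and Q :: "('g, 'd) monoid_scheme" and A :: "('g \<Rightarrow> 'k) set" +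
  assumes mult_regular:
      "(\<lambda>(g, h). g \<otimes>\<^bsub>Q\<^esub> h) \<in>
         regular_maps (carrier Q \<times> carrier Q)
           (product_coordinate_ring K (carrier Q) A (carrier Q) A) (carrier Q) A"
    and inv_regular: "(\<lambda>g. inv\<^bsub>Q\<^esub> g) \<in> regular_maps (carrier Q) A (carrier Q) A"


section \<open>The Lie algebra of an algebraic group\<close>

definition left_translation :: "('g, 'd) monoid_scheme \<Rightarrow> 'g \<Rightarrow> ('g \<Rightarrow> 'k) \<Rightarrow> 'g \<Rightarrow> 'k" where
  "left_translation Q g f = (\<lambda>h\<in>carrier Q. f (inv\<^bsub>Q\<^esub> g \<otimes>\<^bsub>Q\<^esub> h))"

definition left_invariant_derivations ::
  "('k, 'a) ring_scheme \<Rightarrow> ('g, 'd) monoid_scheme \<Rightarrow> ('g \<Rightarrow> 'k) set \<Rightarrow>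
     (('g \<Rightarrow> 'k) \<Rightarrow> 'g \<Rightarrow> 'k) set" where
  "left_invariant_derivations K Q A =
     (let R = (function_algebra K (carrier Q))\<lparr>carrier := A\<rparr>
      in {D \<in> LinearCombinations.module_hom K R R \<inter> extensional A.
            (\<forall>f\<in>A. \<forall>h\<in>A. D (f \<otimes>\<^bsub>R\<^esub> h) = (D f \<otimes>\<^bsub>R\<^esub> h) \<oplus>\<^bsub>R\<^esub> (f \<otimes>\<^bsub>R\<^esub> D h)) \<and>
            (\<forall>g\<in>carrier Q. \<forall>f\<in>A. D (left_translation Q g f) = left_translation Q g (D f))})"

definition Lie ::
  "('k, 'a) ring_scheme \<Rightarrow> ('g, 'd) monoid_scheme \<Rightarrow> ('g \<Rightarrow> 'k) set \<Rightarrow>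
     ('k, ('g \<Rightarrow> 'k) \<Rightarrow> 'g \<Rightarrow> 'k) module" where
  "Lie K Q A =
     (let R = (function_algebra K (carrier Q))\<lparr>carrier := A\<rparr>
      in \<lparr>carrier = left_invariant_derivations K Q A,
          monoid.mult = (\<lambda>D E. \<lambda>f\<in>A. D (E f) \<ominus>\<^bsub>R\<^esub> E (D f)),
          one = (\<lambda>f\<in>A. \<zero>\<^bsub>R\<^esub>),
          zero = (\<lambda>f\<in>A. \<zero>\<^bsub>R\<^esub>),
          add = (\<lambda>D E. \<lambda>f\<in>A. D f \<oplus>\<^bsub>R\<^esub> E f),
          smult = (\<lambda>c D. \<lambda>f\<in>A. c \<odot>\<^bsub>R\<^esub> D f)\<rparr>)"


section \<open>Rational modules and good index behaviour\<close>

definition matrix_coefficient ::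
  "('g, 'd) monoid_scheme \<Rightarrow> ('g \<Rightarrow> 'v \<Rightarrow> 'v) \<Rightarrow> ('v \<Rightarrow> 'k) \<Rightarrow> 'v \<Rightarrow> 'g \<Rightarrow> 'k" where
  "matrix_coefficient Q \<rho> l v = (\<lambda>g\<in>carrier Q. l (\<rho> g v))"

locale rational_module = algebraic_group K Q A + V: vectorspace K V + group_action Q "carrier V" \<rho>
  for K :: "('k, 'a) ring_scheme" and Q :: "('g, 'd) monoid_scheme" and A :: "('g \<Rightarrow> 'k) set"
    and V :: "('k, 'v, 'b) module_scheme" and \<rho> :: "'g \<Rightarrow> 'v \<Rightarrow> 'v" +
  assumes finite_dimensional: "V.fin_dim"
    and linear: "g \<in> carrier Q \<Longrightarrow> \<rho> g \<in> LinearCombinations.module_hom K V V"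
    and rational: "\<lbrakk>l \<in> carrier (dual K V); v \<in> carrier V\<rbrakk> \<Longrightarrow> matrix_coefficient Q \<rho> l v \<in> A"

text \<open>The differential of \<open>\<rho>\<close>. A left invariant derivation \<open>D\<close> corresponds to the tangent vector
  \<open>f \<mapsto> (D f)(1)\<close> at the identity, and the differential of \<open>\<rho>\<close> applies this tangent vector to
  the matrix coefficients of \<open>\<rho>\<close>.\<close>

definition differential ::
  "('k, 'a) ring_scheme \<Rightarrow> ('g, 'd) monoid_scheme \<Rightarrow> ('k, 'v, 'b) module_scheme \<Rightarrow>
     ('g \<Rightarrow> 'v \<Rightarrow> 'v) \<Rightarrow> (('g \<Rightarrow> 'k) \<Rightarrow> 'g \<Rightarrow> 'k) \<Rightarrow> 'v \<Rightarrow> 'v" where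
  "differential K Q V \<rho> D = (\<lambda>v\<in>carrier V. THE u. u \<in> carrier V \<and>
     (\<forall>l\<in>carrier (dual K V). l u = D (matrix_coefficient Q \<rho> l v) \<one>\<^bsub>Q\<^esub>))"

definition good_index_behaviour ::
  "('k, 'a) ring_scheme \<Rightarrow> ('g, 'd) monoid_scheme \<Rightarrow> ('g \<Rightarrow> 'k) set \<Rightarrow>
     ('k, 'v, 'b) module_scheme \<Rightarrow> ('g \<Rightarrow> 'v \<Rightarrow> 'v) \<Rightarrow> bool" where
  "good_index_behaviour K Q A U \<rho> \<longleftrightarrow>
     lie_good_index_behaviour K (Lie K Q A) U (differential K Q U \<rho>)"

end

theory Submission
  imports Defs
begin

text \<open>Evaluation identifies \<open>U\<close> with its bidual, and under this identification the orbits of \<open>\<qq>\<close> in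
  \<open>U**\<close> become the spaces \<open>\<qq> u\<close>. Hence \<open>ind(\<qq>, U* ) = dim U - dim \<qq>\<close> iff some \<open>u \<in> U\<close>
  has trivial stabiliser. Since \<open>dim (V/\<qq> v) - dim \<qq>\<^sub>v = dim V - dim \<qq>\<close>, the same criterion applied to
  the \<open>\<qq>\<^sub>v\<close>-modules \<open>V/\<qq> v\<close> turns the hypothesis on \<open>V\<close> into: for every \<open>v\<close> there is
  \<open>u \<in> V\<close> such that \<open>x v = 0\<close> and \<open>x u \<in> \<qq> v\<close> imply \<open>x = 0\<close>. If \<open>u\<close> works for \<open>v\<close>, then
  \<open>(0, u)\<close> works for \<open>(w, v) \<in> W \<oplus> V\<close>, whatever \<open>w\<close> is.\<close>

section \<open>Linear algebra\<close>

text \<open>No maximal orbit dimension is ever computed. The index takes its least possible value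
  exactly when some orbit map \<open>x \<mapsto> x u\<close> is injective, so each claim about an
  index becomes the search for a witness. Padding a witness for \<open>V\<close> by zero is harmless
  because only second components are compared: \<open>x (w, v) = 0\<close> contains
  \<open>x v = 0\<close>, and \<open>x (0, u) = y (w, v)\<close> contains \<open>x u = y v\<close>.

  The index hypothesis enters twice. It fixes the value that good index behaviour of
  \<open>V\<close> prescribes for all quotients, and its witness shows that the sum attains its own
  least value; only then can good index behaviour of the sum be translated in the same way. The last
  claim concerns the sum of the duals, which is not literally the dual of the sum, so it gets a
  witness of its own.

  Most of the length goes into the passage from the group to its Lie algebra: the Lie algebra has
  finite dimension, the differential of a rational module respects brackets (which lets the
  stabiliser of \<open>v\<close> act on the quotient by its orbit space), and the differential of a
  direct sum is the sum of the differentials.\<close>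

lemma module_homI:
  assumes "\<And>v. v \<in> carrier V \<Longrightarrow> f v \<in> carrier W"
    and "\<And>v w. \<lbrakk>v \<in> carrier V; w \<in> carrier V\<rbrakk> \<Longrightarrow> f (v \<oplus>\<^bsub>V\<^esub> w) = f v \<oplus>\<^bsub>W\<^esub> f w"
    and "\<And>c v. \<lbrakk>c \<in> carrier K; v \<in> carrier V\<rbrakk> \<Longrightarrow> f (c \<odot>\<^bsub>V\<^esub> v) = c \<odot>\<^bsub>W\<^esub> f v"
  shows "f \<in> LinearCombinations.module_hom K V W"
  using assms unfolding LinearCombinations.module_hom_def by auto

lemma module_hom_in_carrier:
  "\<lbrakk>f \<in> LinearCombinations.module_hom K V W; v \<in> carrier V\<rbrakk> \<Longrightarrow> f v \<in> carrier W"
  using LinearCombinations.module_hom_closed by blast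

lemma linear_mapI:
  assumes "vectorspace K V" "vectorspace K W" "T \<in> LinearCombinations.module_hom K V W"
  shows "linear_map K V W T"
  using assms by (simp add: linear_map_def mod_hom_def mod_hom_axioms_def vectorspace_def)

lemma (in vectorspace) subspaceI:
  assumes "N \<subseteq> carrier V" "\<zero>\<^bsub>V\<^esub> \<in> N"
    and "\<And>v w. \<lbrakk>v \<in> N; w \<in> N\<rbrakk> \<Longrightarrow> v \<oplus>\<^bsub>V\<^esub> w \<in> N"
    and "\<And>c v. \<lbrakk>c \<in> carrier K; v \<in> N\<rbrakk> \<Longrightarrow> c \<odot>\<^bsub>V\<^esub> v \<in> N"
  shows "VectorSpace.subspace K N V"
  using assms
  by (intro subspace.intro submodule.intro vectorspace_axioms module_axioms) blast+

text \<open>An injective map carries independent sets to independent sets of equal size, so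
  \<open>W.dim\<close> bounds them all; a maximal one then exists and generates. Subspaces, function
  spaces and the Lie algebra get their finite dimension from this.\<close>

lemma (in linear_map) inj_fin_dim:
  assumes inj: "inj_on T (carrier V)" and fd: "W.fin_dim"
  shows "V.fin_dim"
proof -
  have bound: "finite A \<and> card A \<le> W.dim"
    if A: "A \<subseteq> carrier V \<and> V.module.lin_indpt A" for A
  \<comment> \<open>\<open>A\<close> may be infinite a priori, so its finite subsets are
    counted.\<close>
  proof (rule finite_if_finite_subsets_card_bdd)
    fix B assume B: "B \<subseteq> A" "finite B"
    have BV: "B \<subseteq> carrier V" and li: "V.module.lin_indpt B"
      using A B V.module.subset_li_is_li by auto
    have "W.module.lin_indpt (T ` B)"
    proof (rule W.module.finite_lin_indpt2)
      show "finite (T ` B)" "T ` B \<subseteq> carrier W" using B BV by auto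
      fix a assume a: "a \<in> T ` B \<rightarrow> carrier K"
        and lc: "W.module.lincomb a (T ` B) = \<zero>\<^bsub>W\<^esub>"
      have aT: "a \<circ> T \<in> B \<rightarrow> carrier K" using a by auto
      have "T (V.module.lincomb (a \<circ> T) B) = T \<zero>\<^bsub>V\<^esub>"
        using lincomb_linear_image[OF inj BV a B(2)] lc by simp
      then have "V.module.lincomb (a \<circ> T) B = \<zero>\<^bsub>V\<^esub>"
        using inj_onD[OF inj, of "V.module.lincomb (a \<circ> T) B" "\<zero>\<^bsub>V\<^esub>"] BV aT by simp
      then have "(a \<circ> T) \<in> B \<rightarrow> {\<zero>\<^bsub>K\<^esub>}"
        using V.not_lindepD[OF li B(2) subset_refl aT] by simp
      then show "\<forall>v\<in>T ` B. a v = \<zero>\<^bsub>K\<^esub>" by auto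
    qed
    moreover have "T ` B \<subseteq> carrier W" using BV by auto
    ultimately have "card (T ` B) \<le> W.dim" using W.li_le_dim fd by blast
    then show "card B \<le> W.dim"
      using card_image inj BV by (metis inj_on_subset)
  qed
  have "V.module.lin_indpt {}" unfolding V.module.lin_dep_def by auto
  then obtain A where A: "finite A" "maximal A (\<lambda>S. S \<subseteq> carrier V \<and> V.module.lin_indpt S)"
    using maximal_exists[where P = "\<lambda>S. S \<subseteq> carrier V \<and> V.module.lin_indpt S"
        and N = "W.dim" and B = "{}"] bound by blast
  then show ?thesis
    using V.max_li_is_gen[OF A(2)] unfolding V.fin_dim_def maximal_def by blast
qed

lemma (in vectorspace) subspace_fin_dim:
  assumes "VectorSpace.subspace K N V" "fin_dim"
  shows "vectorspace.fin_dim K (vs N)"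
proof -
  have "linear_map K (vs N) V id"
  proof (rule linear_mapI[OF subspace_is_vs[OF assms(1)] vectorspace_axioms], rule module_homI)
    show "id v \<in> carrier V" if "v \<in> carrier (vs N)" for v
      using that submodule.subset[OF subspace.submod[OF assms(1)]] by auto
  qed simp_all
  then show ?thesis
    using linear_map.inj_fin_dim[of K "vs N" V id] assms by simp
qed

lemma (in vectorspace) dim_0_imp_trivial:
  assumes "fin_dim" "dim = 0"
  shows "carrier V = {\<zero>\<^bsub>V\<^esub>}"
proof -
  obtain B where B: "finite B" "basis B" using finite_basis_exists assms by blast
  then have "B = {}" using dim_basis assms by auto
  then show ?thesis using B unfolding basis_def by (simp add: span_empty)
qed

text \<open>By rank-nullity, equality means a kernel of dimension 0, which is trivial because the
  kernel is finite-dimensional. For an orbit map the image is an orbit space and the kernel a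
  stabiliser: here dimensions turn into witnesses.\<close>

lemma (in linear_map) dim_image_eq_iff_inj:
  assumes "V.fin_dim"
  shows "vectorspace.dim K (W.vs (T ` carrier V)) = V.dim \<longleftrightarrow>
    (\<forall>v\<in>carrier V. T v = \<zero>\<^bsub>W\<^esub> \<longrightarrow> v = \<zero>\<^bsub>V\<^esub>)"
proof -
  interpret ker: vectorspace K "V.vs kerT"
    by (rule V.subspace_is_vs[OF kerT_is_subspace])
  have "V.dim = vectorspace.dim K (W.vs (T ` carrier V)) + ker.dim"
    using rank_nullity[OF assms] unfolding im_def by simp
  moreover have "ker.fin_dim"
    using V.subspace_fin_dim[OF kerT_is_subspace assms] .
  then have "ker.dim = 0 \<longleftrightarrow> kerT = {\<zero>\<^bsub>V\<^esub>}"
    using ker.dim_0_imp_trivial Ke0_imp_inj inj_imp_dim_ker0 by auto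
  moreover have "kerT = {\<zero>\<^bsub>V\<^esub>} \<longleftrightarrow> (\<forall>v\<in>carrier V. T v = \<zero>\<^bsub>W\<^esub> \<longrightarrow> v = \<zero>\<^bsub>V\<^esub>)"
    unfolding ker_def by auto
  ultimately show ?thesis by auto
qed

lemma (in linear_map) dim_image_le:
  assumes "V.fin_dim"
  shows "vectorspace.dim K (W.vs (T ` carrier V)) \<le> V.dim"
  using rank_nullity[OF assms] unfolding im_def by simp

section \<open>Direct sums of vector spaces\<close>

lemma direct_sum_simps [simp]:
  "carrier (direct_sum V W) = carrier V \<times> carrier W"
  "\<zero>\<^bsub>direct_sum V W\<^esub> = (\<zero>\<^bsub>V\<^esub>, \<zero>\<^bsub>W\<^esub>)"
  "(v, w) \<oplus>\<^bsub>direct_sum V W\<^esub> (v', w') = (v \<oplus>\<^bsub>V\<^esub> v', w \<oplus>\<^bsub>W\<^esub> w')"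
  "c \<odot>\<^bsub>direct_sum V W\<^esub> (v, w) = (c \<odot>\<^bsub>V\<^esub> v, c \<odot>\<^bsub>W\<^esub> w)"
  by (simp_all add: direct_sum_def)

lemma (in linear_map) image_span:
  assumes "S \<subseteq> carrier V" "v \<in> V.module.span S"
  shows "T v \<in> W.module.span (T ` S)"
proof -
  have sub: "T ` S \<subseteq> carrier W" using assms by auto
  interpret N: submodule K "W.module.span (T ` S)" W
    using W.module.span_is_submodule[OF sub] .
  have "VectorSpace.subspace K {v \<in> carrier V. T v \<in> W.module.span (T ` S)} V"
    by (rule V.subspaceI) auto
  moreover have "S \<subseteq> {v \<in> carrier V. T v \<in> W.module.span (T ` S)}"
    using assms W.module.in_own_span[OF sub] by auto
  ultimately have "V.module.span S \<subseteq> {v \<in> carrier V. T v \<in> W.module.span (T ` S)}"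
    using V.module.span_is_subset by (simp add: subspace_def)
  then show ?thesis using assms by blast
qed

text \<open>Rank-nullity for the projection \<open>snd\<close>, whose kernel is a copy of
  \<open>V\<close>. Finite dimension has to come first, from the union of the two embedded
  generating sets.\<close>

lemma direct_sum_dim:
  assumes "vectorspace K V" "vectorspace K W"
    and "vectorspace.fin_dim K V" "vectorspace.fin_dim K W"
  shows "vectorspace.fin_dim K (direct_sum V W)"
    and "vectorspace.dim K (direct_sum V W) = vectorspace.dim K V + vectorspace.dim K W"
proof -
  interpret V: vectorspace K V by fact
  interpret W: vectorspace K W by fact
  interpret S: vectorspace K "direct_sum V W" by (rule direct_sum_is_vs) fact+
  have i: "linear_map K V (direct_sum V W) (\<lambda>v. (v, \<zero>\<^bsub>W\<^esub>))"
    by (intro linear_mapI module_homI) (auto intro: assms S.vectorspace_axioms)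
  have j: "linear_map K W (direct_sum V W) (\<lambda>w. (\<zero>\<^bsub>V\<^esub>, w))"
    by (intro linear_mapI module_homI) (auto intro: assms S.vectorspace_axioms)
  interpret p: linear_map K "direct_sum V W" W snd
    by (intro linear_mapI module_homI) (auto intro: assms S.vectorspace_axioms)
  obtain A B where A: "finite A" "A \<subseteq> carrier V" "V.module.span A = carrier V"
    and B: "finite B" "B \<subseteq> carrier W" "W.module.span B = carrier W"
    using assms unfolding V.fin_dim_def W.fin_dim_def by blast
  let ?C = "(\<lambda>v. (v, \<zero>\<^bsub>W\<^esub>)) ` A \<union> (\<lambda>w. (\<zero>\<^bsub>V\<^esub>, w)) ` B"
  have C: "?C \<subseteq> carrier (direct_sum V W)" using A B by auto
  interpret N: submodule K "S.module.span ?C" "direct_sum V W"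
    using S.module.span_is_submodule[OF C] .
  have "x \<in> S.module.span ?C" if x: "x \<in> carrier (direct_sum V W)" for x
  proof -
    obtain v w where [simp]: "x = (v, w)" "v \<in> carrier V" "w \<in> carrier W" using x by auto
    have "(v, \<zero>\<^bsub>W\<^esub>) \<in> S.module.span ?C"
      using subsetD[OF S.module.span_is_monotone[OF Un_upper1] linear_map.image_span[OF i A(2), of v]] A(3)
      by simp
    moreover have "(\<zero>\<^bsub>V\<^esub>, w) \<in> S.module.span ?C"
      using subsetD[OF S.module.span_is_monotone[OF Un_upper2] linear_map.image_span[OF j B(2), of w]] B(3)
      by simp
    ultimately have "(v, \<zero>\<^bsub>W\<^esub>) \<oplus>\<^bsub>direct_sum V W\<^esub> (\<zero>\<^bsub>V\<^esub>, w) \<in> S.module.span ?C"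
      by (rule N.m_closed)
    then show ?thesis by simp
  qed
  then have gen: "S.module.span ?C = carrier (direct_sum V W)"
    by (intro equalityI[OF N.subset] subsetI)
  show fd: "S.fin_dim"
    unfolding S.fin_dim_def
    by (intro exI[of _ ?C] conjI finite_UnI finite_imageI A(1) B(1) C gen)
  have "p.kerT = (\<lambda>v. (v, \<zero>\<^bsub>W\<^esub>)) ` carrier V"
    unfolding p.ker_def by auto
  moreover have "vectorspace.dim K (S.vs ((\<lambda>v. (v, \<zero>\<^bsub>W\<^esub>)) ` carrier V)) = V.dim"
    using linear_map.dim_image_eq_iff_inj[OF i assms(3)] by simp
  moreover have "p.imT = carrier W"
  proof
    show "carrier W \<subseteq> p.imT"
    proof
      fix w assume "w \<in> carrier W"
      then show "w \<in> p.imT"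
        unfolding p.im_def by (intro image_eqI[of _ _ "(\<zero>\<^bsub>V\<^esub>, w)"]) simp_all
    qed
  qed (auto simp: p.im_def)
  ultimately show "S.dim = V.dim + W.dim"
    using p.rank_nullity[OF fd] by simp
qed

section \<open>The ground field as a space over itself, and functions on a set\<close>

lemma base_module_simps [simp]:
  "carrier (base_module K) = carrier K" "\<zero>\<^bsub>base_module K\<^esub> = \<zero>\<^bsub>K\<^esub>"
  "a \<oplus>\<^bsub>base_module K\<^esub> b = a \<oplus>\<^bsub>K\<^esub> b" "a \<odot>\<^bsub>base_module K\<^esub> b = a \<otimes>\<^bsub>K\<^esub> b"
  by (simp_all add: base_module_def)

lemma (in field) base_module_vectorspace: "vectorspace R (base_module R)"
proof (rule vs_criteria)
  show "field R" ..
  show "\<forall>v\<in>carrier (base_module R). \<exists>neg_v\<in>carrier (base_module R).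
      v \<oplus>\<^bsub>base_module R\<^esub> neg_v = \<zero>\<^bsub>base_module R\<^esub>"
    using r_neg by force
qed (auto simp: a_ac m_assoc l_distr r_distr)

lemma (in field) base_module_fin_dim: "vectorspace.fin_dim R (base_module R)"
proof -
  interpret B: vectorspace R "base_module R" by (rule base_module_vectorspace)
  interpret N: submodule R "B.module.span {\<one>}" "base_module R"
    by (rule B.module.span_is_submodule) simp
  have "\<one> \<in> B.module.span {\<one>}" using B.module.in_own_span[of "{\<one>}"] by simp
  then have "c \<in> B.module.span {\<one>}" if "c \<in> carrier R" for c
    using N.smult_closed[OF that, of \<one>] that by simp
  then have "B.module.span {\<one>} = carrier (base_module R)" using N.subset by auto
  then show ?thesis unfolding B.fin_dim_def by (intro exI[of _ "{\<one>}"]) simp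
qed

lemma (in ring) func_space_simps [simp]:
  "carrier (func_space S) = S \<rightarrow>\<^sub>E carrier R"
  "\<zero>\<^bsub>func_space S\<^esub> = (\<lambda>v\<in>S. \<zero>)"
  "f \<oplus>\<^bsub>func_space S\<^esub> g = (\<lambda>v\<in>S. f v \<oplus> g v)"
  "c \<odot>\<^bsub>func_space S\<^esub> f = (\<lambda>v\<in>S. c \<otimes> f v)"
  by (simp_all add: func_space_def)

lemma (in field) func_space_vectorspace: "vectorspace R (func_space S)"
  using func_space_is_module field_axioms by (simp add: vectorspace_def)

text \<open>Splitting off the value at one point embeds the functions on \<open>insert x S\<close>
  into the sum of the ground field and the functions on \<open>S\<close>. In
  \<open>Lie_fin_dim\<close> the set is one of generators of the coordinate ring.\<close>

lemma (in field) func_space_fin_dim: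
  assumes "finite S"
  shows "vectorspace.fin_dim R (func_space S)"
  using assms
proof (induction S)
  case empty
  interpret E: vectorspace R "func_space {}" by (rule func_space_vectorspace)
  show ?case unfolding E.fin_dim_def
    by (intro exI[of _ "{}"]) (simp add: E.span_empty restrict_def)
next
  case (insert x S)
  interpret E: vectorspace R "func_space S" by (rule func_space_vectorspace)
  interpret B: vectorspace R "base_module R" by (rule base_module_vectorspace)
  interpret D: vectorspace R "direct_sum (base_module R) (func_space S)"
    by (rule direct_sum_is_vs) (fact B.vectorspace_axioms E.vectorspace_axioms)+
  have "linear_map R (func_space (insert x S)) (direct_sum (base_module R) (func_space S))
      (\<lambda>f. (f x, restrict f S))"
    by (intro linear_mapI module_homI func_space_vectorspace D.vectorspace_axioms)
      (auto simp: fun_eq_iff restrict_def)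
  moreover have "D.fin_dim"
    by (rule direct_sum_dim(1))
      (fact B.vectorspace_axioms E.vectorspace_axioms base_module_fin_dim insert.IH)+
  moreover have "inj_on (\<lambda>f. (f x, restrict f S)) (carrier (func_space (insert x S)))"
  proof (rule inj_onI)
    fix f g assume fg: "f \<in> carrier (func_space (insert x S))" "g \<in> carrier (func_space (insert x S))"
      and eq: "(f x, restrict f S) = (g x, restrict g S)"
    have "f v = g v" if "v \<in> insert x S" for v
      using eq that by (metis Pair_inject insertE restrict_apply')
    then show "f = g" using fg by (auto intro: PiE_ext)
  qed
  ultimately show ?case by (simp add: linear_map.inj_fin_dim)
qed

subsection \<open>Duality\<close>

lemma (in vectorspace) dual_simps [simp]:
  "\<zero>\<^bsub>dual K V\<^esub> = (\<lambda>v\<in>carrier V. \<zero>\<^bsub>K\<^esub>)"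
  "f \<oplus>\<^bsub>dual K V\<^esub> g = (\<lambda>v\<in>carrier V. f v \<oplus>\<^bsub>K\<^esub> g v)"
  "c \<odot>\<^bsub>dual K V\<^esub> f = (\<lambda>v\<in>carrier V. c \<otimes>\<^bsub>K\<^esub> f v)"
  by (simp_all add: dual_def)

lemma dual_carrier:
  "carrier (dual K V) = LinearCombinations.module_hom K V (base_module K) \<inter> extensional (carrier V)"
  by (simp add: dual_def)

lemma dualI:
  assumes "f \<in> extensional (carrier V)" "\<And>v. v \<in> carrier V \<Longrightarrow> f v \<in> carrier K"
    and "\<And>v w. \<lbrakk>v \<in> carrier V; w \<in> carrier V\<rbrakk> \<Longrightarrow> f (v \<oplus>\<^bsub>V\<^esub> w) = f v \<oplus>\<^bsub>K\<^esub> f w"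
    and "\<And>c v. \<lbrakk>c \<in> carrier K; v \<in> carrier V\<rbrakk> \<Longrightarrow> f (c \<odot>\<^bsub>V\<^esub> v) = c \<otimes>\<^bsub>K\<^esub> f v"
  shows "f \<in> carrier (dual K V)"
  using assms by (auto simp: dual_carrier intro!: module_homI)

lemma dualD:
  assumes "f \<in> carrier (dual K V)"
  shows "f \<in> extensional (carrier V)" "v \<in> carrier V \<Longrightarrow> f v \<in> carrier K"
    and "\<lbrakk>v \<in> carrier V; w \<in> carrier V\<rbrakk> \<Longrightarrow> f (v \<oplus>\<^bsub>V\<^esub> w) = f v \<oplus>\<^bsub>K\<^esub> f w"
    and "\<lbrakk>c \<in> carrier K; v \<in> carrier V\<rbrakk> \<Longrightarrow> f (c \<odot>\<^bsub>V\<^esub> v) = c \<otimes>\<^bsub>K\<^esub> f v"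
  using assms LinearCombinations.module_hom_closed[of f K V "base_module K"]
  by (auto simp: dual_carrier LinearCombinations.module_hom_add LinearCombinations.module_hom_smult)

lemma dual_eqI:
  assumes "f \<in> carrier (dual K V)" "g \<in> carrier (dual K V)"
    and "\<And>v. v \<in> carrier V \<Longrightarrow> f v = g v"
  shows "f = g"
  using assms dualD(1) extensionalityI by metis

lemma (in vectorspace) dual_vectorspace: "vectorspace K (dual K V)"
proof -
  interpret F: vectorspace K "func_space (carrier V)" by (rule func_space_vectorspace)
  have "VectorSpace.subspace K (carrier (dual K V)) (func_space (carrier V))"
  proof (rule F.subspaceI)
    show "carrier (dual K V) \<subseteq> carrier (func_space (carrier V))"
      using dualD(1,2) by (fastforce simp: PiE_def)
    show "\<zero>\<^bsub>func_space (carrier V)\<^esub> \<in> carrier (dual K V)"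
      by (rule dualI) auto
    show "f \<oplus>\<^bsub>func_space (carrier V)\<^esub> g \<in> carrier (dual K V)"
      if "f \<in> carrier (dual K V)" "g \<in> carrier (dual K V)" for f g
      by (rule dualI) (simp_all add: dualD[OF that(1)] dualD[OF that(2)] r_distr R.a_ac)
    show "c \<odot>\<^bsub>func_space (carrier V)\<^esub> f \<in> carrier (dual K V)"
      if "c \<in> carrier K" "f \<in> carrier (dual K V)" for c f
      by (rule dualI) (simp_all add: that dualD[OF that(2)] r_distr m_lcomm)
  qed
  from F.subspace_is_vs[OF this] show ?thesis
    by (simp add: dual_def)
qed

text \<open>Coefficients are unique among functions that are \<open>undefined\<close> off
  \<open>B\<close>, and \<open>c\<close> is defined by this uniqueness; \<open>uniq\<close> then
  returns to arbitrary coefficient functions, which yields linearity in the vector.\<close>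

lemma (in vectorspace) coordinates:
  assumes "finite B" "basis B"
  obtains c where "\<And>v b. \<lbrakk>v \<in> carrier V; b \<in> B\<rbrakk> \<Longrightarrow> c v b \<in> carrier K"
    and "\<And>v. v \<in> carrier V \<Longrightarrow> lincomb (c v) B = v"
    and "\<And>a b. \<lbrakk>a \<in> B \<rightarrow> carrier K; b \<in> B\<rbrakk> \<Longrightarrow> c (lincomb a B) b = a b"
    and "\<And>v w b. \<lbrakk>v \<in> carrier V; w \<in> carrier V; b \<in> B\<rbrakk> \<Longrightarrow> c (v \<oplus>\<^bsub>V\<^esub> w) b = c v b \<oplus>\<^bsub>K\<^esub> c w b"
    and "\<And>r v b. \<lbrakk>r \<in> carrier K; v \<in> carrier V; b \<in> B\<rbrakk> \<Longrightarrow> c (r \<odot>\<^bsub>V\<^esub> v) b = r \<otimes>\<^bsub>K\<^esub> c v b"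
proof -
  have B: "B \<subseteq> carrier V" using assms(2) unfolding basis_def by simp
  have ex1: "\<exists>!a. a \<in> B \<rightarrow>\<^sub>E carrier K \<and> lincomb a B = v" if "v \<in> carrier V" for v
    using basis_criterion[OF assms(1) B] assms(2) that by blast
  define c where "c v = (THE a. a \<in> B \<rightarrow>\<^sub>E carrier K \<and> lincomb a B = v)" for v
  have c: "c v \<in> B \<rightarrow>\<^sub>E carrier K" "lincomb (c v) B = v" if "v \<in> carrier V" for v
    using theI'[OF ex1[OF that]] unfolding c_def by auto
  have uniq: "c (lincomb a B) b = a b" if a: "a \<in> B \<rightarrow> carrier K" and b: "b \<in> B" for a b
  proof -
    have "lincomb (restrict a B) B = lincomb a B"
      by (rule lincomb_cong) (use B a in auto)
    then have "c (lincomb a B) = restrict a B"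
      unfolding c_def by (intro the1_equality ex1) (use B a in auto)
    then show ?thesis using b by simp
  qed
  show ?thesis
  proof
    show "c v b \<in> carrier K" if "v \<in> carrier V" "b \<in> B" for v b
      using c(1)[OF that(1)] that(2) by auto
    show "lincomb (c v) B = v" if "v \<in> carrier V" for v using c(2) that .
    show "c (lincomb a B) b = a b" if "a \<in> B \<rightarrow> carrier K" "b \<in> B" for a b using uniq that .
    show "c (v \<oplus>\<^bsub>V\<^esub> w) b = c v b \<oplus>\<^bsub>K\<^esub> c w b"
      if "v \<in> carrier V" "w \<in> carrier V" "b \<in> B" for v w b
    proof -
      have C: "c v \<in> B \<rightarrow> carrier K" "c w \<in> B \<rightarrow> carrier K" using c(1) that by (auto simp: PiE_def)
      have "lincomb (\<lambda>b. c v b \<oplus>\<^bsub>K\<^esub> c w b) B = v \<oplus>\<^bsub>V\<^esub> w"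
        using lincomb_sum[OF assms(1) B C] c(2) that by simp
      then show ?thesis using uniq[of "\<lambda>b. c v b \<oplus>\<^bsub>K\<^esub> c w b" b] C that by auto
    qed
    show "c (r \<odot>\<^bsub>V\<^esub> v) b = r \<otimes>\<^bsub>K\<^esub> c v b"
      if "r \<in> carrier K" "v \<in> carrier V" "b \<in> B" for r v b
    proof -
      have C: "c v \<in> B \<rightarrow> carrier K" using c(1) that by (auto simp: PiE_def)
      have "lincomb (\<lambda>b. r \<otimes>\<^bsub>K\<^esub> c v b) B = r \<odot>\<^bsub>V\<^esub> v"
        using lincomb_smult[OF B C] c(2) that by simp
      then show ?thesis using uniq[of "\<lambda>b. r \<otimes>\<^bsub>K\<^esub> c v b" b] C that by auto
    qed
  qed
qed

lemma (in vectorspace) dual_zero: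
  assumes "f \<in> carrier (dual K V)"
  shows "f \<zero>\<^bsub>V\<^esub> = \<zero>\<^bsub>K\<^esub>"
  using dualD(2)[OF assms] dualD(4)[OF assms, of "\<zero>\<^bsub>K\<^esub>" "\<zero>\<^bsub>V\<^esub>"] by simp

lemma (in vectorspace) dual_finsum:
  assumes f: "f \<in> carrier (dual K V)" and "finite A" "g \<in> A \<rightarrow> carrier V"
  shows "f (\<Oplus>\<^bsub>V\<^esub>a\<in>A. g a) = (\<Oplus>\<^bsub>K\<^esub>a\<in>A. f (g a))"
  using assms(2,3)
proof (induction A)
  case empty
  show ?case by (simp add: dual_zero[OF f])
next
  case (insert a A)
  then show ?case
    using dualD(2)[OF f] dualD(3)[OF f]
    by (subst M.finsum_insert, auto)  (subst R.finsum_insert, auto)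
qed

text \<open>\<open>S\<close> is the bilinear form for which the chosen basis is orthonormal. Its
  symmetry is exported because it exchanges points with functionals: \<open>dual_separates\<close>
  and \<open>bidual_evaluation\<close> both come from it.\<close>

lemma (in vectorspace) symmetric_iso_dual:
  assumes "fin_dim"
  obtains S where "linear_map K V (dual K V) S" "bij_betw S (carrier V) (carrier (dual K V))"
    and "\<And>v w. \<lbrakk>v \<in> carrier V; w \<in> carrier V\<rbrakk> \<Longrightarrow> S v w = S w v"
proof -
  obtain B where B: "finite B" "basis B" using finite_basis_exists assms by blast
  then have BV: "B \<subseteq> carrier V" unfolding basis_def by simp
  obtain c where c [simp]: "\<And>v b. \<lbrakk>v \<in> carrier V; b \<in> B\<rbrakk> \<Longrightarrow> c v b \<in> carrier K"
    and lc: "\<And>v. v \<in> carrier V \<Longrightarrow> lincomb (c v) B = v"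
    and cl: "\<And>a b. \<lbrakk>a \<in> B \<rightarrow> carrier K; b \<in> B\<rbrakk> \<Longrightarrow> c (lincomb a B) b = a b"
    and add: "\<And>v w b. \<lbrakk>v \<in> carrier V; w \<in> carrier V; b \<in> B\<rbrakk> \<Longrightarrow> c (v \<oplus>\<^bsub>V\<^esub> w) b = c v b \<oplus>\<^bsub>K\<^esub> c w b"
    and smult: "\<And>r v b. \<lbrakk>r \<in> carrier K; v \<in> carrier V; b \<in> B\<rbrakk> \<Longrightarrow> c (r \<odot>\<^bsub>V\<^esub> v) b = r \<otimes>\<^bsub>K\<^esub> c v b"
    by (rule coordinates[OF B]) (rule that)
  define S where "S v = (\<lambda>w\<in>carrier V. \<Oplus>\<^bsub>K\<^esub>b\<in>B. c v b \<otimes>\<^bsub>K\<^esub> c w b)" for v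
  have finsum_closed': "(\<Oplus>\<^bsub>K\<^esub>b\<in>B. c v b \<otimes>\<^bsub>K\<^esub> c w b) \<in> carrier K"
    if "v \<in> carrier V" "w \<in> carrier V" for v w
    using that by (intro R.finsum_closed) auto
  have sym: "S v w = S w v" if "v \<in> carrier V" "w \<in> carrier V" for v w
    unfolding S_def using that by (auto intro!: R.finsum_cong' simp: m_comm)
  have S_add: "S v (w \<oplus>\<^bsub>V\<^esub> x) = S v w \<oplus>\<^bsub>K\<^esub> S v x"
    if "v \<in> carrier V" "w \<in> carrier V" "x \<in> carrier V" for v w x
  proof -
    have "(\<Oplus>\<^bsub>K\<^esub>b\<in>B. c v b \<otimes>\<^bsub>K\<^esub> c (w \<oplus>\<^bsub>V\<^esub> x) b)
      = (\<Oplus>\<^bsub>K\<^esub>b\<in>B. c v b \<otimes>\<^bsub>K\<^esub> c w b \<oplus>\<^bsub>K\<^esub> c v b \<otimes>\<^bsub>K\<^esub> c x b)"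
      using that by (intro R.finsum_cong') (auto simp: add r_distr)
    also have "\<dots> = (\<Oplus>\<^bsub>K\<^esub>b\<in>B. c v b \<otimes>\<^bsub>K\<^esub> c w b) \<oplus>\<^bsub>K\<^esub> (\<Oplus>\<^bsub>K\<^esub>b\<in>B. c v b \<otimes>\<^bsub>K\<^esub> c x b)"
      using that by (intro R.finsum_addf) auto
    finally show ?thesis using that by (simp add: S_def)
  qed
  have S_smult: "S v (r \<odot>\<^bsub>V\<^esub> w) = r \<otimes>\<^bsub>K\<^esub> S v w"
    if "v \<in> carrier V" "w \<in> carrier V" "r \<in> carrier K" for v w r
  proof -
    have "(\<Oplus>\<^bsub>K\<^esub>b\<in>B. c v b \<otimes>\<^bsub>K\<^esub> c (r \<odot>\<^bsub>V\<^esub> w) b) = (\<Oplus>\<^bsub>K\<^esub>b\<in>B. r \<otimes>\<^bsub>K\<^esub> (c v b \<otimes>\<^bsub>K\<^esub> c w b))"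
      using that by (intro R.finsum_cong') (auto simp: smult m_lcomm)
    also have "\<dots> = r \<otimes>\<^bsub>K\<^esub> (\<Oplus>\<^bsub>K\<^esub>b\<in>B. c v b \<otimes>\<^bsub>K\<^esub> c w b)"
      using that B(1) by (intro R.finsum_rdistr[symmetric]) auto
    finally show ?thesis using that by (simp add: S_def)
  qed
  have S_dual: "S v \<in> carrier (dual K V)" if "v \<in> carrier V" for v
    by (rule dualI) (use that S_add S_smult finsum_closed' in \<open>auto simp: S_def\<close>)
  interpret D: vectorspace K "dual K V" by (rule dual_vectorspace)
  have hom: "S \<in> LinearCombinations.module_hom K V (dual K V)"
  proof (rule module_homI)
    show "S v \<in> carrier (dual K V)" if "v \<in> carrier V" for v using S_dual that .
    show "S (v \<oplus>\<^bsub>V\<^esub> w) = S v \<oplus>\<^bsub>dual K V\<^esub> S w" if "v \<in> carrier V" "w \<in> carrier V" for v w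
      by (rule dual_eqI[of _ K V]) (use that S_dual S_add sym in \<open>auto simp del: dual_simps\<close>, simp add: sym S_add)
    show "S (r \<odot>\<^bsub>V\<^esub> v) = r \<odot>\<^bsub>dual K V\<^esub> S v" if "r \<in> carrier K" "v \<in> carrier V" for r v
      by (rule dual_eqI[of _ K V]) (use that S_dual S_smult sym in \<open>auto simp del: dual_simps\<close>, simp add: sym S_smult)
  qed
  \<comment> \<open>A functional is represented by the vector whose coordinates are its values on
    the basis.\<close>
  have eval: "S (lincomb f B) = f" if f: "f \<in> carrier (dual K V)" for f
  proof (rule dual_eqI[OF _ f])
    have fB: "f \<in> B \<rightarrow> carrier K" using dualD(2)[OF f] BV by auto
    then have lf: "lincomb f B \<in> carrier V" using BV by simp
    then show "S (lincomb f B) \<in> carrier (dual K V)" by (rule S_dual)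
    fix w assume w: "w \<in> carrier V"
    have "f w = f (\<Oplus>\<^bsub>V\<^esub>b\<in>B. c w b \<odot>\<^bsub>V\<^esub> b)" using lc[OF w] by (simp add: lincomb_def)
    also have "\<dots> = (\<Oplus>\<^bsub>K\<^esub>b\<in>B. f (c w b \<odot>\<^bsub>V\<^esub> b))"
      by (rule dual_finsum[OF f B(1)]) (use w BV in auto)
    also have "\<dots> = (\<Oplus>\<^bsub>K\<^esub>b\<in>B. c (lincomb f B) b \<otimes>\<^bsub>K\<^esub> c w b)"
      using w fB BV dualD(4)[OF f] by (intro R.finsum_cong') (auto simp: cl m_comm subset_iff Pi_iff)
    finally show "S (lincomb f B) w = f w" using w by (simp add: S_def)
  qed
  have "bij_betw S (carrier V) (carrier (dual K V))"
  proof (rule bij_betw_byWitness[where f' = "\<lambda>f. lincomb f B"])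
    show "\<forall>f\<in>carrier (dual K V). S (lincomb f B) = f" using eval by simp
    show "S ` carrier V \<subseteq> carrier (dual K V)" using S_dual by auto
    show "(\<lambda>f. lincomb f B) ` carrier (dual K V) \<subseteq> carrier V"
    proof (rule image_subsetI, rule lincomb_closed[OF BV])
      show "f \<in> B \<rightarrow> carrier K" if "f \<in> carrier (dual K V)" for f
        using dualD(2)[OF that] BV by auto
    qed
    show "\<forall>v\<in>carrier V. lincomb (S v) B = v"
    proof
      fix v assume v: "v \<in> carrier V"
      \<comment> \<open>The coordinates of a basis vector form a Kronecker delta, so the sum
        defining \<open>S v b\<close> keeps a single term.\<close>
      have "S v b = c v b" if b: "b \<in> B" for b
      proof -
        have bV: "b \<in> carrier V" using b BV by auto
        have "lincomb (\<lambda>x. if x = b then \<one>\<^bsub>K\<^esub> else \<zero>\<^bsub>K\<^esub>) B = b"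
        proof -
          have "lincomb (\<lambda>x. if x = b then \<one>\<^bsub>K\<^esub> else \<zero>\<^bsub>K\<^esub>) B = (\<Oplus>\<^bsub>V\<^esub>x\<in>B. if b = x then x else \<zero>\<^bsub>V\<^esub>)"
            unfolding lincomb_def by (rule M.finsum_cong') (use BV in auto)
          also have "\<dots> = b" using M.finsum_singleton[OF b B(1), of "\<lambda>x. x"] BV by auto
          finally show ?thesis .
        qed
        then have cb: "c b x = (if x = b then \<one>\<^bsub>K\<^esub> else \<zero>\<^bsub>K\<^esub>)" if "x \<in> B" for x
          using cl[of "\<lambda>x. if x = b then \<one>\<^bsub>K\<^esub> else \<zero>\<^bsub>K\<^esub>" x] that by auto
        have "(\<Oplus>\<^bsub>K\<^esub>x\<in>B. c v x \<otimes>\<^bsub>K\<^esub> c b x) = (\<Oplus>\<^bsub>K\<^esub>x\<in>B. if b = x then c v x else \<zero>\<^bsub>K\<^esub>)"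
          by (rule R.finsum_cong') (use v in \<open>auto simp: cb\<close>)
        also have "\<dots> = c v b" using R.finsum_singleton[OF b B(1), of "c v"] v by auto
        finally show ?thesis using bV by (simp add: S_def)
      qed
      then have "lincomb (S v) B = lincomb (c v) B"
        by (intro lincomb_cong) (use BV v in auto)
      then show "lincomb (S v) B = v" using lc[OF v] by simp
    qed
  qed
  then show thesis
    using that[OF linear_mapI[OF vectorspace_axioms dual_vectorspace hom]] sym by blast
qed

lemma (in vectorspace) dual_fin_dim:
  assumes "fin_dim"
  shows "vectorspace.fin_dim K (dual K V)" "vectorspace.dim K (dual K V) = dim"
proof -
  obtain S where S: "linear_map K V (dual K V) S" "bij_betw S (carrier V) (carrier (dual K V))"
    by (rule symmetric_iso_dual[OF assms]) (rule that)
  show "vectorspace.fin_dim K (dual K V)"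
    using linear_map.surj_fin_dim[OF S(1) assms] S(2) by (simp add: bij_betw_def)
  show "vectorspace.dim K (dual K V) = dim"
    using linear_map.dim_eq[OF S(1) assms] S(2) by (simp add: bij_betw_def)
qed

text \<open>By symmetry \<open>S v x = S x v = S x w = S w x\<close> for every \<open>x\<close>, and
  \<open>S\<close> is injective.\<close>

lemma (in vectorspace) dual_separates:
  assumes "fin_dim" "v \<in> carrier V" "w \<in> carrier V"
    and "\<And>f. f \<in> carrier (dual K V) \<Longrightarrow> f v = f w"
  shows "v = w"
proof -
  obtain S where S: "linear_map K V (dual K V) S" "bij_betw S (carrier V) (carrier (dual K V))"
    and sym: "\<And>v w. \<lbrakk>v \<in> carrier V; w \<in> carrier V\<rbrakk> \<Longrightarrow> S v w = S w v"
    by (rule symmetric_iso_dual[OF assms(1)]) (rule that)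
  have mem: "S x \<in> carrier (dual K V)" if "x \<in> carrier V" for x
    using S(2) that by (auto simp: bij_betw_def)
  have "S v = S w"
    by (rule dual_eqI[of _ K V]) (use assms mem sym in metis)+
  then show ?thesis using S(2) assms by (auto simp: bij_betw_def inj_on_def)
qed

text \<open>Pulled back along \<open>S\<close>, \<open>\<Xi>\<close> becomes a functional on
  \<open>V\<close>, hence equals some \<open>S v\<close>; symmetry makes this \<open>v\<close> the
  point at which \<open>\<Xi>\<close> evaluates.\<close>

lemma (in vectorspace) bidual_evaluation:
  assumes "fin_dim" "\<Xi> \<in> carrier (dual K (dual K V))"
  obtains v where "v \<in> carrier V" "\<And>f. f \<in> carrier (dual K V) \<Longrightarrow> \<Xi> f = f v"
proof -
  interpret D: vectorspace K "dual K V" by (rule dual_vectorspace)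
  obtain S where S: "linear_map K V (dual K V) S" "bij_betw S (carrier V) (carrier (dual K V))"
    and sym: "\<And>v w. \<lbrakk>v \<in> carrier V; w \<in> carrier V\<rbrakk> \<Longrightarrow> S v w = S w v"
    by (rule symmetric_iso_dual[OF assms(1)]) (rule that)
  interpret S: linear_map K V "dual K V" S by fact
  have mem: "S x \<in> carrier (dual K V)" if "x \<in> carrier V" for x
    using S(2) that by (auto simp: bij_betw_def)
  have "(\<lambda>v\<in>carrier V. \<Xi> (S v)) \<in> carrier (dual K V)"
    by (rule dualI) (simp_all add: mem dualD[OF assms(2)] del: dual_simps)
  then obtain v where v: "v \<in> carrier V" "S v = (\<lambda>v\<in>carrier V. \<Xi> (S v))"
    using S(2) by (metis bij_betw_imp_surj_on imageE)
  have "\<Xi> f = f v" if "f \<in> carrier (dual K V)" for f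
  proof -
    obtain w where w: "w \<in> carrier V" "f = S w"
      using S(2) \<open>f \<in> carrier (dual K V)\<close> by (metis bij_betw_imp_surj_on imageE)
    then have "\<Xi> f = S v w" using v by simp
    then show ?thesis using sym v w by simp
  qed
  with v(1) show thesis by (rule that)
qed

lemma (in vectorspace) evaluation_in_bidual:
  assumes "v \<in> carrier V"
  shows "(\<lambda>f\<in>carrier (dual K V). f v) \<in> carrier (dual K (dual K V))"
proof -
  interpret D: vectorspace K "dual K V" by (rule dual_vectorspace)
  show ?thesis
    using assms D.module.M.a_closed D.module.smult_closed
    by (intro dualI) (auto simp: dualD(2))
qed

subsection \<open>Quotients\<close>

locale quotient_space = vectorspace K V + N?: submodule K N V for K V N
begin

text \<open>Makes the coset calculus of additive subgroups available; negatives arise as multiples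
  by minus one.\<close>

sublocale additive: abelian_subgroup N V
proof -
  have "subgroup N (add_monoid V)"
  proof (rule add.subgroupI)
    show "N \<subseteq> carrier V" by (rule N.subset)
    show "N \<noteq> {}" using N.zero_closed by blast
    show "\<ominus>\<^bsub>V\<^esub> v \<in> N" if "v \<in> N" for v
    proof -
      have "(\<ominus>\<^bsub>K\<^esub> \<one>\<^bsub>K\<^esub>) \<odot>\<^bsub>V\<^esub> v \<in> N" using that by simp
      moreover have "v \<in> carrier V" using that N.subset by (rule subsetD[rotated])
      ultimately show ?thesis by (simp only: smult_minus_1)
    qed
    show "v \<oplus>\<^bsub>V\<^esub> w \<in> N" if "v \<in> N" "w \<in> N" for v w
      using N.m_closed that by blast
  qed
  then show "abelian_subgroup N V"
    by (intro abelian_subgroupI3 additive_subgroup.intro M.abelian_group_axioms)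
qed

lemma quotient_carrier: "carrier (quotient_module V N) = (\<lambda>v. N +>\<^bsub>V\<^esub> v) ` carrier V"
  by (auto simp: quotient_module_def A_RCOSETS_def')

lemma coset_eq_self_iff:
  assumes "v \<in> carrier V"
  shows "N +>\<^bsub>V\<^esub> v = N \<longleftrightarrow> v \<in> N"
  using assms additive.a_rcos_const additive.a_rcos_self by metis

text \<open>As \<open>f\<close> preserves \<open>N\<close>, all members of the union are one and the
  same coset. This is the well-definedness of the two operations given as unions over
  representatives, scalar multiplication and \<open>quotient_act\<close>.\<close>

lemma Union_cosets:
  assumes "f \<in> LinearCombinations.module_hom K V V" "f ` N \<subseteq> N" "v \<in> carrier V"
  shows "(\<Union>u\<in>N +>\<^bsub>V\<^esub> v. N +>\<^bsub>V\<^esub> f u) = N +>\<^bsub>V\<^esub> f v"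
proof -
  have "N +>\<^bsub>V\<^esub> f u = N +>\<^bsub>V\<^esub> f v" if u: "u \<in> N +>\<^bsub>V\<^esub> v" for u
  proof -
    obtain h where h: "h \<in> N" "u = h \<oplus>\<^bsub>V\<^esub> v"
      using u unfolding a_r_coset_def' by auto
    have "f u = f h \<oplus>\<^bsub>V\<^esub> f v"
      using LinearCombinations.module_hom_add[OF assms(1)] h assms(3) by simp
    then have "f u \<in> N +>\<^bsub>V\<^esub> f v"
      using h(1) assms(2) unfolding a_r_coset_def' by auto
    then show ?thesis
      using additive.a_repr_independence' module_hom_in_carrier[OF assms(1,3)] by blast
  qed
  then show ?thesis
    by (intro UN_constant_eq[of v] ballI additive.a_rcos_self assms(3))
qed

lemma quotient_zero: "\<zero>\<^bsub>quotient_module V N\<^esub> = N"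
  by (simp add: quotient_module_def)

lemma quotient_add:
  assumes "v \<in> carrier V" "w \<in> carrier V"
  shows "(N +>\<^bsub>V\<^esub> v) \<oplus>\<^bsub>quotient_module V N\<^esub> (N +>\<^bsub>V\<^esub> w) = N +>\<^bsub>V\<^esub> (v \<oplus>\<^bsub>V\<^esub> w)"
  using additive.a_rcos_sum[OF assms] by (simp add: quotient_module_def)

lemma quotient_smult:
  assumes "c \<in> carrier K" "v \<in> carrier V"
  shows "c \<odot>\<^bsub>quotient_module V N\<^esub> (N +>\<^bsub>V\<^esub> v) = N +>\<^bsub>V\<^esub> (c \<odot>\<^bsub>V\<^esub> v)"
proof -
  have "(\<lambda>u. c \<odot>\<^bsub>V\<^esub> u) \<in> LinearCombinations.module_hom K V V"
    using assms(1) by (intro module_homI) (simp_all add: smult_r_distr smult_assoc1[symmetric] m_comm)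
  then show ?thesis
    using assms by (simp add: quotient_module_def Union_cosets image_subset_iff)
qed

lemma quotient_vectorspace: "vectorspace K (quotient_module V N)"
proof (rule vs_criteria)
  show "field K" ..
  show "\<forall>C\<in>carrier (quotient_module V N). \<exists>C'\<in>carrier (quotient_module V N).
      C \<oplus>\<^bsub>quotient_module V N\<^esub> C' = \<zero>\<^bsub>quotient_module V N\<^esub>"
  proof
    fix C assume "C \<in> carrier (quotient_module V N)"
    then obtain v where v: "v \<in> carrier V" "C = N +>\<^bsub>V\<^esub> v" by (auto simp: quotient_carrier)
    then have "C \<oplus>\<^bsub>quotient_module V N\<^esub> (N +>\<^bsub>V\<^esub> (\<ominus>\<^bsub>V\<^esub> v)) = \<zero>\<^bsub>quotient_module V N\<^esub>"
      by (simp add: quotient_add quotient_zero M.r_neg coset_eq_self_iff)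
    then show "\<exists>C'\<in>carrier (quotient_module V N).
        C \<oplus>\<^bsub>quotient_module V N\<^esub> C' = \<zero>\<^bsub>quotient_module V N\<^esub>"
      using v(1) by (auto simp: quotient_carrier)
  qed
  \<comment> \<open>The zero of the quotient is the set \<open>N\<close>; it must be recognised as a
    coset before the rules for cosets apply.\<close>
  have "N = N +>\<^bsub>V\<^esub> \<zero>\<^bsub>V\<^esub>" using coset_eq_self_iff[of "\<zero>\<^bsub>V\<^esub>"] by simp
  then show "\<zero>\<^bsub>quotient_module V N\<^esub> \<in> carrier (quotient_module V N)"
    by (auto simp: quotient_zero quotient_carrier)
  show "\<forall>C\<in>carrier (quotient_module V N). C \<oplus>\<^bsub>quotient_module V N\<^esub> \<zero>\<^bsub>quotient_module V N\<^esub> = C"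
  proof
    fix C assume "C \<in> carrier (quotient_module V N)"
    then obtain v where v: "v \<in> carrier V" "C = N +>\<^bsub>V\<^esub> v" by (auto simp: quotient_carrier)
    have "C \<oplus>\<^bsub>quotient_module V N\<^esub> (N +>\<^bsub>V\<^esub> \<zero>\<^bsub>V\<^esub>) = C"
      using v by (simp add: quotient_add del: a_coset_add_zero)
    then show "C \<oplus>\<^bsub>quotient_module V N\<^esub> \<zero>\<^bsub>quotient_module V N\<^esub> = C"
      using \<open>N = N +>\<^bsub>V\<^esub> \<zero>\<^bsub>V\<^esub>\<close> by (simp add: quotient_zero)
  qed
qed (auto simp: quotient_carrier quotient_add quotient_smult M.a_ac smult_l_distr smult_r_distr
    smult_assoc1)

lemma quotient_map_linear: "linear_map K V (quotient_module V N) (\<lambda>v. N +>\<^bsub>V\<^esub> v)"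
  by (intro linear_mapI module_homI vectorspace_axioms quotient_vectorspace)
    (auto simp: quotient_carrier quotient_add quotient_smult)

lemma quotient_fin_dim:
  assumes "fin_dim"
  shows "vectorspace.fin_dim K (quotient_module V N)"
    and "vectorspace.dim K (quotient_module V N) + vectorspace.dim K (vs N) = dim"
proof -
  interpret q: linear_map K V "quotient_module V N" "\<lambda>v. N +>\<^bsub>V\<^esub> v"
    by (rule quotient_map_linear)
  have im: "(\<lambda>v. N +>\<^bsub>V\<^esub> v) ` carrier V = carrier (quotient_module V N)"
    by (simp add: quotient_carrier)
  show "vectorspace.fin_dim K (quotient_module V N)"
    by (rule q.surj_fin_dim[OF assms im])
  have "q.kerT = N"
    using coset_eq_self_iff N.subset unfolding q.ker_def quotient_zero by blast
  moreover have "q.imT = carrier (quotient_module V N)" using im by (simp add: q.im_def)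
  ultimately show "vectorspace.dim K (quotient_module V N) + vectorspace.dim K (vs N) = dim"
    using q.rank_nullity[OF assms] by simp
qed

end

section \<open>Linear actions and their index\<close>

lemma lie_index_cong:
  assumes "\<And>x. x \<in> carrier L \<Longrightarrow> act x = act' x"
  shows "lie_index K L U act = lie_index K L U act'"
proof -
  have "orbit_space L (dual_act K U act) = orbit_space L (dual_act K U act')"
    unfolding orbit_space_def dual_act_def using assms by (intro ext image_cong) simp_all
  then show ?thesis by (simp add: lie_index_def)
qed

text \<open>Every ingredient of the definition looks at \<open>act x\<close> only for
  \<open>x\<close> in \<open>carrier L\<close>. The differential of a direct sum will be identified
  with the sum of the differentials on the Lie algebra alone.\<close>

lemma lie_good_index_behaviour_cong:
  fixes U :: "('k, 'v, 'b) module_scheme"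
  assumes "\<And>x. x \<in> carrier L \<Longrightarrow> act x = act' x"
  shows "lie_good_index_behaviour K L U act \<longleftrightarrow> lie_good_index_behaviour K L U act'"
proof -
  have orb: "orbit_space L act = orbit_space L act'"
    unfolding orbit_space_def using assms by (intro ext image_cong) simp_all
  have st: "stabiliser L U act = stabiliser L U act'"
    unfolding stabiliser_def using assms by (intro ext) (simp cong: conj_cong)
  have "lie_index K L (dual K U) (dual_act K U act) = lie_index K L (dual K U) (dual_act K U act')"
    by (rule lie_index_cong) (simp add: dual_act_def assms fun_eq_iff)
  moreover have "lie_index K (stabiliser L U act' v) (dual K M) (dual_act K M (quotient_act U N act)) =
      lie_index K (stabiliser L U act' v) (dual K M) (dual_act K M (quotient_act U N act'))"
    for v N and M :: "('k, 'v set) module"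
    by (rule lie_index_cong) (simp add: dual_act_def quotient_act_def stabiliser_def assms fun_eq_iff)
  ultimately show ?thesis
    unfolding lie_good_index_behaviour_def Let_def orb st by simp
qed

text \<open>A bilinear pairing of finite-dimensional spaces is all that the index sees. Working in
  this generality covers duals and quotients without carrying brackets along.\<close>

locale linear_action = L: vectorspace K L + U: vectorspace K U
  for K :: "('k, 'a) ring_scheme" and L :: "('k, 'x, 'c) module_scheme"
    and U :: "('k, 'v, 'b) module_scheme" and act :: "'x \<Rightarrow> 'v \<Rightarrow> 'v" +
  assumes fin_dim_L: "L.fin_dim" and fin_dim_U: "U.fin_dim"
    and orbit_map_hom: "u \<in> carrier U \<Longrightarrow> (\<lambda>x. act x u) \<in> LinearCombinations.module_hom K L U"
    and act_hom: "x \<in> carrier L \<Longrightarrow> act x \<in> LinearCombinations.module_hom K U U"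
begin

lemma act_closed [simp]: "\<lbrakk>x \<in> carrier L; u \<in> carrier U\<rbrakk> \<Longrightarrow> act x u \<in> carrier U"
  using module_hom_in_carrier[OF act_hom] .

lemma act_add [simp]:
  "\<lbrakk>x \<in> carrier L; u \<in> carrier U; v \<in> carrier U\<rbrakk> \<Longrightarrow> act x (u \<oplus>\<^bsub>U\<^esub> v) = act x u \<oplus>\<^bsub>U\<^esub> act x v"
  using LinearCombinations.module_hom_add[OF act_hom] .

lemma act_smult [simp]:
  "\<lbrakk>x \<in> carrier L; c \<in> carrier K; u \<in> carrier U\<rbrakk> \<Longrightarrow> act x (c \<odot>\<^bsub>U\<^esub> u) = c \<odot>\<^bsub>U\<^esub> act x u"
  using LinearCombinations.module_hom_smult[OF act_hom] .

lemma add_act [simp]: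
  "\<lbrakk>x \<in> carrier L; y \<in> carrier L; u \<in> carrier U\<rbrakk> \<Longrightarrow> act (x \<oplus>\<^bsub>L\<^esub> y) u = act x u \<oplus>\<^bsub>U\<^esub> act y u"
  using LinearCombinations.module_hom_add[OF orbit_map_hom] .

lemma smult_act [simp]:
  "\<lbrakk>c \<in> carrier K; x \<in> carrier L; u \<in> carrier U\<rbrakk> \<Longrightarrow> act (c \<odot>\<^bsub>L\<^esub> x) u = c \<odot>\<^bsub>U\<^esub> act x u"
  using LinearCombinations.module_hom_smult[OF orbit_map_hom] .

lemma orbit_map_linear: "u \<in> carrier U \<Longrightarrow> linear_map K L U (\<lambda>x. act x u)"
  by (intro linear_mapI L.vectorspace_axioms U.vectorspace_axioms orbit_map_hom)

lemma dual_action: "linear_action K L (dual K U) (dual_act K U act)"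
proof -
  interpret D: vectorspace K "dual K U" by (rule U.dual_vectorspace)
  have closed: "dual_act K U act x \<xi> \<in> carrier (dual K U)"
    if "x \<in> carrier L" "\<xi> \<in> carrier (dual K U)" for x \<xi>
    by (rule dualI) (simp_all add: dual_act_def that dualD[OF that(2)] L.module.R.minus_add L.module.R.r_minus)
  show ?thesis
  proof
    show "D.fin_dim" by (rule U.dual_fin_dim[OF fin_dim_U])
    show "L.fin_dim" by (rule fin_dim_L)
    show "(\<lambda>x. dual_act K U act x \<xi>) \<in> LinearCombinations.module_hom K L (dual K U)"
      if "\<xi> \<in> carrier (dual K U)" for \<xi>
    proof (rule module_homI)
      show "dual_act K U act (x \<oplus>\<^bsub>L\<^esub> y) \<xi> = dual_act K U act x \<xi> \<oplus>\<^bsub>dual K U\<^esub> dual_act K U act y \<xi>"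
        if "x \<in> carrier L" "y \<in> carrier L" for x y
        by (simp add: dual_act_def fun_eq_iff restrict_def that dualD[OF \<open>\<xi> \<in> carrier (dual K U)\<close>] L.module.R.minus_add)
      show "dual_act K U act (c \<odot>\<^bsub>L\<^esub> x) \<xi> = c \<odot>\<^bsub>dual K U\<^esub> dual_act K U act x \<xi>"
        if "c \<in> carrier K" "x \<in> carrier L" for c x
        by (simp add: dual_act_def fun_eq_iff restrict_def that dualD[OF \<open>\<xi> \<in> carrier (dual K U)\<close>] L.module.R.r_minus)
    qed (rule closed[OF _ that])
    show "dual_act K U act x \<in> LinearCombinations.module_hom K (dual K U) (dual K U)"
      if "x \<in> carrier L" for x
    proof (rule module_homI)
      show "dual_act K U act x (\<xi> \<oplus>\<^bsub>dual K U\<^esub> \<eta>) = dual_act K U act x \<xi> \<oplus>\<^bsub>dual K U\<^esub> dual_act K U act x \<eta>"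
        if "\<xi> \<in> carrier (dual K U)" "\<eta> \<in> carrier (dual K U)" for \<xi> \<eta>
        by (simp add: dual_act_def fun_eq_iff restrict_def \<open>x \<in> carrier L\<close> dualD[OF that(1)] dualD[OF that(2)] L.module.R.minus_add)
      show "dual_act K U act x (c \<odot>\<^bsub>dual K U\<^esub> \<xi>) = c \<odot>\<^bsub>dual K U\<^esub> dual_act K U act x \<xi>"
        if "c \<in> carrier K" "\<xi> \<in> carrier (dual K U)" for c \<xi>
        by (simp add: dual_act_def fun_eq_iff restrict_def \<open>x \<in> carrier L\<close> that dualD[OF that(2)] L.module.R.r_minus)
    qed (rule closed[OF that])
  qed
qed

text \<open>Orbits have dimension at most \<open>dim L\<close>, so this is the least conceivable value of the index.\<close>

lemma index_minimal_iff:
  "lie_index K L U act = int U.dim - int L.dim \<longleftrightarrow>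
    (\<exists>\<xi>\<in>carrier (dual K U). \<forall>x\<in>carrier L. dual_act K U act x \<xi> = \<zero>\<^bsub>dual K U\<^esub> \<longrightarrow> x = \<zero>\<^bsub>L\<^esub>)"
proof -
  interpret D: linear_action K L "dual K U" "dual_act K U act" by (rule dual_action)
  define d where "d \<xi> = vectorspace.dim K ((dual K U)\<lparr>carrier := orbit_space L (dual_act K U act) \<xi>\<rparr>)"
    for \<xi>
  have le: "d \<xi> \<le> L.dim" if "\<xi> \<in> carrier (dual K U)" for \<xi>
    using linear_map.dim_image_le[OF D.orbit_map_linear[OF that] fin_dim_L]
    by (simp add: d_def orbit_space_def)
  have eq: "d \<xi> = L.dim \<longleftrightarrow> (\<forall>x\<in>carrier L. dual_act K U act x \<xi> = \<zero>\<^bsub>dual K U\<^esub> \<longrightarrow> x = \<zero>\<^bsub>L\<^esub>)"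
    if "\<xi> \<in> carrier (dual K U)" for \<xi>
    using linear_map.dim_image_eq_iff_inj[OF D.orbit_map_linear[OF that] fin_dim_L]
    by (simp add: d_def orbit_space_def del: U.dual_simps)
  have ne: "d ` carrier (dual K U) \<noteq> {}"
    using imageI[OF D.U.module.M.zero_closed, of d] by (metis empty_iff)
  \<comment> \<open>There may be infinitely many functionals, but their orbit dimensions are natural
    numbers up to \<open>L.dim\<close>; together with \<open>ne\<close> this makes
    \<open>Max\<close> a genuine maximum.\<close>
  have fin: "finite (d ` carrier (dual K U))"
    by (rule finite_subset[OF _ finite_atMost[of L.dim]])
      (intro image_subsetI atMost_iff[THEN iffD2] le)
  have "lie_index K L U act = int U.dim - int L.dim \<longleftrightarrow> Max (d ` carrier (dual K U)) = L.dim"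
    unfolding lie_index_def d_def by linarith
  also have "\<dots> \<longleftrightarrow> L.dim \<in> d ` carrier (dual K U)"
    unfolding Max_eq_iff[OF fin ne] using le by (simp only: ball_simps) simp
  also have "\<dots> \<longleftrightarrow> (\<exists>\<xi>\<in>carrier (dual K U). d \<xi> = L.dim)"
    unfolding image_iff by (simp only: eq_commute)
  also have "\<dots> \<longleftrightarrow> (\<exists>\<xi>\<in>carrier (dual K U). \<forall>x\<in>carrier L.
      dual_act K U act x \<xi> = \<zero>\<^bsub>dual K U\<^esub> \<longrightarrow> x = \<zero>\<^bsub>L\<^esub>)"
    by (rule bex_cong[OF refl eq])
  finally show ?thesis .
qed

text \<open>The signs of the two dualisations cancel.\<close>

lemma dual_dual_act_evaluation:
  assumes "u \<in> carrier U" "x \<in> carrier L"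
  shows "dual_act K (dual K U) (dual_act K U act) x (\<lambda>\<xi>\<in>carrier (dual K U). \<xi> u) =
    (\<lambda>\<xi>\<in>carrier (dual K U). \<xi> (act x u))"
proof -
  interpret D: linear_action K L "dual K U" "dual_act K U act" by (rule dual_action)
  show ?thesis
    using assms by (auto simp: dual_act_def[of K "dual K U"] restrict_def fun_eq_iff dualD(2))
      (simp add: dual_act_def dualD(2))
qed

text \<open>This is \<open>index_minimal_iff\<close> for the dual action. Functionals on the dual
  are evaluations, \<open>x\<close> moves evaluation at \<open>u\<close> to evaluation at
  \<open>act x u\<close>, and an evaluation vanishes only at the zero vector.\<close>

lemma dual_index_minimal_iff:
  "lie_index K L (dual K U) (dual_act K U act) = int U.dim - int L.dim \<longleftrightarrow>
    (\<exists>u\<in>carrier U. \<forall>x\<in>carrier L. act x u = \<zero>\<^bsub>U\<^esub> \<longrightarrow> x = \<zero>\<^bsub>L\<^esub>)"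
proof -
  interpret D: linear_action K L "dual K U" "dual_act K U act" by (rule dual_action)
  let ?ev = "\<lambda>u. \<lambda>\<xi>\<in>carrier (dual K U). \<xi> u"
  have "?ev u = \<zero>\<^bsub>dual K (dual K U)\<^esub> \<longleftrightarrow> u = \<zero>\<^bsub>U\<^esub>" if "u \<in> carrier U" for u
  proof
    assume "?ev u = \<zero>\<^bsub>dual K (dual K U)\<^esub>"
    then have "\<xi> u = \<xi> \<zero>\<^bsub>U\<^esub>" if "\<xi> \<in> carrier (dual K U)" for \<xi>
      using that U.dual_zero[OF that] by (auto simp: fun_eq_iff restrict_def split: if_splits)
    then show "u = \<zero>\<^bsub>U\<^esub>" using U.dual_separates[OF fin_dim_U] that U.module.M.zero_closed by metis
  qed (auto simp: U.dual_zero)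
  then have "(\<forall>x\<in>carrier L. act x u = \<zero>\<^bsub>U\<^esub> \<longrightarrow> x = \<zero>\<^bsub>L\<^esub>) \<longleftrightarrow>
      (\<forall>x\<in>carrier L. dual_act K (dual K U) (dual_act K U act) x (?ev u) = \<zero>\<^bsub>dual K (dual K U)\<^esub>
        \<longrightarrow> x = \<zero>\<^bsub>L\<^esub>)" if "u \<in> carrier U" for u
    using that by (simp add: dual_dual_act_evaluation del: D.U.dual_simps)
  moreover have "carrier (dual K (dual K U)) = ?ev ` carrier U"
  proof
    show "?ev ` carrier U \<subseteq> carrier (dual K (dual K U))"
      by (intro image_subsetI U.evaluation_in_bidual)
    show "carrier (dual K (dual K U)) \<subseteq> ?ev ` carrier U"
    proof
      fix \<Xi> assume \<Xi>: "\<Xi> \<in> carrier (dual K (dual K U))"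
      then obtain u where u: "u \<in> carrier U" "\<And>\<xi>. \<xi> \<in> carrier (dual K U) \<Longrightarrow> \<Xi> \<xi> = \<xi> u"
        using U.bidual_evaluation[OF fin_dim_U] by metis
      have "\<Xi> = ?ev u"
        by (rule dual_eqI[OF \<Xi> U.evaluation_in_bidual[OF u(1)]]) (simp add: u(2))
      then show "\<Xi> \<in> ?ev ` carrier U" using u(1) by (rule image_eqI)
    qed
  qed
  ultimately show ?thesis
    using D.index_minimal_iff U.dual_fin_dim(2)[OF fin_dim_U] by simp
qed

end

lemma direct_sum_act_apply [simp]:
  "\<lbrakk>v \<in> carrier V; w \<in> carrier W\<rbrakk> \<Longrightarrow> direct_sum_act V W act act' x (v, w) = (act x v, act' x w)"
  by (simp add: direct_sum_act_def)

lemma direct_sum_action: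
  assumes "linear_action K L V act" "linear_action K L W act'"
  shows "linear_action K L (direct_sum V W) (direct_sum_act V W act act')"
proof -
  interpret V: linear_action K L V act by fact
  interpret W: linear_action K L W act' by fact
  interpret S: vectorspace K "direct_sum V W"
    by (intro direct_sum_is_vs V.U.vectorspace_axioms W.U.vectorspace_axioms)
  show ?thesis
  proof
    show "S.fin_dim"
      by (intro direct_sum_dim V.U.vectorspace_axioms W.U.vectorspace_axioms V.fin_dim_U W.fin_dim_U)
    show "V.L.fin_dim" by (rule V.fin_dim_L)
  qed (auto intro!: module_homI)
qed

section \<open>Good index behaviour\<close>

text \<open>The bracket makes the orbit space of \<open>v\<close> invariant under the stabiliser of
  \<open>v\<close> (\<open>stabiliser_orbit\<close>), so that the stabiliser acts on the
  quotient.\<close>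

locale lie_action = linear_action K L U act for K L U act +
  assumes bracket_closed: "\<lbrakk>x \<in> carrier L; y \<in> carrier L\<rbrakk> \<Longrightarrow> x \<otimes>\<^bsub>L\<^esub> y \<in> carrier L"
    and bracket_act: "\<lbrakk>x \<in> carrier L; y \<in> carrier L; u \<in> carrier U\<rbrakk> \<Longrightarrow>
      act (x \<otimes>\<^bsub>L\<^esub> y) u = act x (act y u) \<ominus>\<^bsub>U\<^esub> act y (act x u)"
begin

context
  fixes v assumes v: "v \<in> carrier U"
begin

lemma orbit_subspace: "VectorSpace.subspace K (orbit_space L act v) U"
  using linear_map.imT_is_subspace[OF orbit_map_linear[OF v]]
    mod_hom.im_def[OF linear_map.axioms(3)[OF orbit_map_linear[OF v]]]
  by (simp add: orbit_space_def)

lemma stabiliser_subspace: "VectorSpace.subspace K (carrier (stabiliser L U act v)) L"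
  by (rule L.subspaceI)
    (use v linear_map.T0_is_0[OF orbit_map_linear[OF v]] in \<open>auto simp: stabiliser_def\<close>)

lemma stabiliser_vectorspace: "vectorspace K (stabiliser L U act v)"
  using L.subspace_is_vs[OF stabiliser_subspace] by (simp add: stabiliser_def)

lemma stabiliser_fin_dim: "vectorspace.fin_dim K (stabiliser L U act v)"
  using L.subspace_fin_dim[OF stabiliser_subspace fin_dim_L] by (simp add: stabiliser_def)

interpretation Q: quotient_space K U "orbit_space L act v"
  using orbit_subspace unfolding VectorSpace.subspace_def quotient_space_def by simp

text \<open>From \<open>[x, y] v = x (y v) - y (x v)\<close> and \<open>x v = 0\<close>, the vector
  \<open>x (y v)\<close> is \<open>[x, y] v\<close>, again in the orbit space.\<close>

lemma stabiliser_orbit: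
  assumes "x \<in> carrier (stabiliser L U act v)"
  shows "act x ` orbit_space L act v \<subseteq> orbit_space L act v"
proof -
  have x: "x \<in> carrier L" "act x v = \<zero>\<^bsub>U\<^esub>" using assms by (auto simp: stabiliser_def)
  have "act x (act y v) = act (x \<otimes>\<^bsub>L\<^esub> y) v" if y: "y \<in> carrier L" for y
  proof -
    have "act y \<zero>\<^bsub>U\<^esub> = \<zero>\<^bsub>U\<^esub>"
      using linear_map.T0_is_0[OF linear_mapI[OF U.vectorspace_axioms U.vectorspace_axioms act_hom[OF y]]] .
    then show ?thesis using x y v by (simp add: bracket_act a_minus_def)
  qed
  then show ?thesis using bracket_closed x(1) by (force simp: orbit_space_def)
qed

lemma quotient_act_coset:
  assumes "x \<in> carrier (stabiliser L U act v)" "u \<in> carrier U"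
  shows "quotient_act U (orbit_space L act v) act x (orbit_space L act v +>\<^bsub>U\<^esub> u) =
    orbit_space L act v +>\<^bsub>U\<^esub> act x u"
  using assms Q.Union_cosets[OF act_hom stabiliser_orbit]
  by (simp add: quotient_act_def stabiliser_def)

lemma quotient_action:
  "linear_action K (stabiliser L U act v) (quotient_module U (orbit_space L act v))
    (quotient_act U (orbit_space L act v) act)"
proof -
  interpret S: vectorspace K "stabiliser L U act v" by (rule stabiliser_vectorspace)
  interpret M: vectorspace K "quotient_module U (orbit_space L act v)"
    by (rule Q.quotient_vectorspace)
  have mem: "x \<in> carrier L" if "x \<in> carrier (stabiliser L U act v)" for x
    using that by (simp add: stabiliser_def)
  have ops: "x \<oplus>\<^bsub>stabiliser L U act v\<^esub> y = x \<oplus>\<^bsub>L\<^esub> y" "c \<odot>\<^bsub>stabiliser L U act v\<^esub> x = c \<odot>\<^bsub>L\<^esub> x"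
    for x y c by (simp_all add: stabiliser_def)
  note [simp] = quotient_act_coset Q.quotient_add Q.quotient_smult mem
  show ?thesis
  proof
    show "S.fin_dim" by (rule stabiliser_fin_dim)
    show "M.fin_dim" by (rule Q.quotient_fin_dim[OF fin_dim_U])
    show "(\<lambda>x. quotient_act U (orbit_space L act v) act x C) \<in>
        LinearCombinations.module_hom K (stabiliser L U act v) (quotient_module U (orbit_space L act v))"
      if C: "C \<in> carrier (quotient_module U (orbit_space L act v))" for C
    proof -
      obtain u where u: "u \<in> carrier U" "C = orbit_space L act v +>\<^bsub>U\<^esub> u"
        using C by (auto simp: Q.quotient_carrier)
      show ?thesis
      proof (rule module_homI)
        show "quotient_act U (orbit_space L act v) act x C \<in> carrier (quotient_module U (orbit_space L act v))"
          if "x \<in> carrier (stabiliser L U act v)" for x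
          using that u by (simp add: Q.quotient_carrier)
        show "quotient_act U (orbit_space L act v) act (x \<oplus>\<^bsub>stabiliser L U act v\<^esub> y) C =
            quotient_act U (orbit_space L act v) act x C \<oplus>\<^bsub>quotient_module U (orbit_space L act v)\<^esub>
            quotient_act U (orbit_space L act v) act y C"
          if "x \<in> carrier (stabiliser L U act v)" "y \<in> carrier (stabiliser L U act v)" for x y
          using that S.module.M.a_closed[OF that] u by (simp add: ops)
        show "quotient_act U (orbit_space L act v) act (c \<odot>\<^bsub>stabiliser L U act v\<^esub> x) C =
            c \<odot>\<^bsub>quotient_module U (orbit_space L act v)\<^esub> quotient_act U (orbit_space L act v) act x C"
          if "c \<in> carrier K" "x \<in> carrier (stabiliser L U act v)" for c x
          using that S.module.smult_closed[OF that] u by (simp add: ops)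
      qed
    qed
    show "quotient_act U (orbit_space L act v) act x \<in> LinearCombinations.module_hom K
        (quotient_module U (orbit_space L act v)) (quotient_module U (orbit_space L act v))"
      if "x \<in> carrier (stabiliser L U act v)" for x
      using that by (intro module_homI) (auto simp: Q.quotient_carrier)
  qed
qed

text \<open>The orbit map has the orbit space as image and the stabiliser as kernel, so passing to
  the quotient and passing to the stabiliser lose the same number of dimensions. The least possible
  index is therefore the same for both actions. Integers are used because \<open>U.dim\<close> may
  be the smaller number.\<close>

lemma quotient_dim:
  "int (vectorspace.dim K (quotient_module U (orbit_space L act v))) -
     int (vectorspace.dim K (stabiliser L U act v)) = int U.dim - int L.dim"
proof -
  interpret a: linear_map K L U "\<lambda>x. act x v" by (rule orbit_map_linear[OF v])
  have "a.imT = orbit_space L act v" by (simp add: a.im_def orbit_space_def)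
  moreover have "L.vs a.kerT = stabiliser L U act v" by (simp add: a.ker_def stabiliser_def)
  ultimately show ?thesis
    using a.rank_nullity[OF fin_dim_L] Q.quotient_fin_dim(2)[OF fin_dim_U] by simp
qed

text \<open>This is \<open>dual_index_minimal_iff\<close> for the stabiliser acting on the quotient,
  with the value rewritten by \<open>quotient_dim\<close>. An element \<open>x\<close> of the
  stabiliser kills the coset of \<open>u\<close> when \<open>act x u\<close> lies in the orbit
  space.\<close>

lemma quotient_index_minimal_iff:
  "lie_index K (stabiliser L U act v) (dual K (quotient_module U (orbit_space L act v)))
      (dual_act K (quotient_module U (orbit_space L act v)) (quotient_act U (orbit_space L act v) act)) =
     int U.dim - int L.dim \<longleftrightarrow>
   (\<exists>u\<in>carrier U. \<forall>x\<in>carrier L. act x v = \<zero>\<^bsub>U\<^esub> \<longrightarrow> act x u \<in> orbit_space L act v \<longrightarrow> x = \<zero>\<^bsub>L\<^esub>)"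
proof -
  interpret A: linear_action K "stabiliser L U act v" "quotient_module U (orbit_space L act v)"
    "quotient_act U (orbit_space L act v) act" by (rule quotient_action)
  have st: "x \<in> carrier (stabiliser L U act v) \<longleftrightarrow> x \<in> carrier L \<and> act x v = \<zero>\<^bsub>U\<^esub>" for x
    by (simp add: stabiliser_def)
  have z: "\<zero>\<^bsub>stabiliser L U act v\<^esub> = \<zero>\<^bsub>L\<^esub>" by (simp add: stabiliser_def)
  have fixes_iff: "quotient_act U (orbit_space L act v) act x (orbit_space L act v +>\<^bsub>U\<^esub> u) =
      \<zero>\<^bsub>quotient_module U (orbit_space L act v)\<^esub> \<longleftrightarrow> act x u \<in> orbit_space L act v"
    if "x \<in> carrier (stabiliser L U act v)" "u \<in> carrier U" for x u
    unfolding quotient_act_coset[OF that] Q.quotient_zero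
    by (rule Q.coset_eq_self_iff) (use that in \<open>simp add: st\<close>)
  have "(\<forall>x\<in>carrier (stabiliser L U act v). quotient_act U (orbit_space L act v) act x
        (orbit_space L act v +>\<^bsub>U\<^esub> u) = \<zero>\<^bsub>quotient_module U (orbit_space L act v)\<^esub> \<longrightarrow> x = \<zero>\<^bsub>L\<^esub>) \<longleftrightarrow>
      (\<forall>x\<in>carrier L. act x v = \<zero>\<^bsub>U\<^esub> \<longrightarrow> act x u \<in> orbit_space L act v \<longrightarrow> x = \<zero>\<^bsub>L\<^esub>)"
    if u: "u \<in> carrier U" for u
    by (simp add: Ball_def st fixes_iff[OF _ u] cong: imp_cong) (simp only: imp_conjL)
  then show ?thesis
    using A.dual_index_minimal_iff unfolding quotient_dim z by (simp add: Q.quotient_carrier)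
qed

end

text \<open>The assumption fixes one side of the defining equation, so the equation at
  \<open>v\<close> says that the quotient there has the index treated in
  \<open>quotient_index_minimal_iff\<close>.\<close>

lemma good_index_behaviour_iff:
  assumes "lie_index K L (dual K U) (dual_act K U act) = int U.dim - int L.dim"
  shows "lie_good_index_behaviour K L U act \<longleftrightarrow>
    (\<forall>v\<in>carrier U. \<exists>u\<in>carrier U. \<forall>x\<in>carrier L.
      act x v = \<zero>\<^bsub>U\<^esub> \<longrightarrow> act x u \<in> orbit_space L act v \<longrightarrow> x = \<zero>\<^bsub>L\<^esub>)"
  unfolding lie_good_index_behaviour_def Let_def assms
  by (intro ball_cong refl) (subst quotient_index_minimal_iff[symmetric], auto)

end

section \<open>Index and good index behaviour of direct sums\<close>

lemma direct_sum_lie_action: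
  assumes "lie_action K L V act" "lie_action K L W act'"
  shows "lie_action K L (direct_sum V W) (direct_sum_act V W act act')"
proof -
  interpret V: lie_action K L V act by fact
  interpret W: lie_action K L W act' by fact
  interpret S: linear_action K L "direct_sum V W" "direct_sum_act V W act act'"
    by (rule direct_sum_action) unfold_locales
  \<comment> \<open>The negative is no component of the record \<open>direct_sum\<close>; it is
    identified as the unique additive inverse.\<close>
  have minus: "(v, w) \<ominus>\<^bsub>direct_sum V W\<^esub> (v', w') = (v \<ominus>\<^bsub>V\<^esub> v', w \<ominus>\<^bsub>W\<^esub> w')"
    if "v \<in> carrier V" "w \<in> carrier W" "v' \<in> carrier V" "w' \<in> carrier W" for v w v' w'
  proof -
    have "\<ominus>\<^bsub>direct_sum V W\<^esub> (v', w') = (\<ominus>\<^bsub>V\<^esub> v', \<ominus>\<^bsub>W\<^esub> w')"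
      using that by (intro S.U.module.M.minus_equality)
        (auto simp: V.U.module.M.l_neg W.U.module.M.l_neg)
    then show ?thesis by (simp add: a_minus_def)
  qed
  show ?thesis
    by unfold_locales (auto simp: V.bracket_closed V.bracket_act W.bracket_act minus)
qed

lemma direct_sum_good_index_behaviour:
  assumes "lie_action K L W act'" "lie_action K L V act"
    and ind: "lie_index K L (dual K V) (dual_act K V act) =
      int (vectorspace.dim K V) - int (vectorspace.dim K L)"
    and gib: "lie_good_index_behaviour K L V act"
  shows "lie_good_index_behaviour K L (direct_sum W V) (direct_sum_act W V act' act)"
proof -
  interpret W: lie_action K L W act' by fact
  interpret V: lie_action K L V act by fact
  interpret S: lie_action K L "direct_sum W V" "direct_sum_act W V act' act"
    by (rule direct_sum_lie_action) fact+
  obtain v0 where v0: "v0 \<in> carrier V" "\<And>x. \<lbrakk>x \<in> carrier L; act x v0 = \<zero>\<^bsub>V\<^esub>\<rbrakk> \<Longrightarrow> x = \<zero>\<^bsub>L\<^esub>"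
    using ind V.dual_index_minimal_iff by auto
  \<comment> \<open>The zero-padded \<open>v0\<close> has trivial stabiliser, so the sum also
    attains its least index, as \<open>good_index_behaviour_iff\<close> requires.\<close>
  have ind_sum: "lie_index K L (dual K (direct_sum W V))
      (dual_act K (direct_sum W V) (direct_sum_act W V act' act)) = int S.U.dim - int W.L.dim"
    unfolding S.dual_index_minimal_iff by (rule bexI[of _ "(\<zero>\<^bsub>W\<^esub>, v0)"]) (use v0 in auto)
  show ?thesis
    unfolding S.good_index_behaviour_iff[OF ind_sum]
  proof
    fix p assume "p \<in> carrier (direct_sum W V)"
    then obtain w v where p: "p = (w, v)" "w \<in> carrier W" "v \<in> carrier V" by auto
    obtain u where u: "u \<in> carrier V"
      "\<And>x. \<lbrakk>x \<in> carrier L; act x v = \<zero>\<^bsub>V\<^esub>; act x u \<in> orbit_space L act v\<rbrakk> \<Longrightarrow> x = \<zero>\<^bsub>L\<^esub>"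
      using gib p(3) V.good_index_behaviour_iff[OF ind] by meson
    show "\<exists>u\<in>carrier (direct_sum W V). \<forall>x\<in>carrier L. direct_sum_act W V act' act x p = \<zero>\<^bsub>direct_sum W V\<^esub>
        \<longrightarrow> direct_sum_act W V act' act x u \<in> orbit_space L (direct_sum_act W V act' act) p
        \<longrightarrow> x = \<zero>\<^bsub>L\<^esub>"
      by (rule bexI[of _ "(\<zero>\<^bsub>W\<^esub>, u)"]) (use u p in \<open>auto simp: orbit_space_def\<close>)
  qed
qed

text \<open>For a sum of duals the criterion to use is \<open>index_minimal_iff\<close>; its witness
  is a functional on pairs \<open>(f, g)\<close>.\<close>

lemma direct_sum_dual_index:
  assumes "linear_action K L V act" "linear_action K L W act'"
    and ind: "lie_index K L (dual K V) (dual_act K V act) =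
      int (vectorspace.dim K V) - int (vectorspace.dim K L)"
  shows "lie_index K L (direct_sum (dual K V) (dual K W))
      (direct_sum_act (dual K V) (dual K W) (dual_act K V act) (dual_act K W act')) =
    int (vectorspace.dim K V) + int (vectorspace.dim K W) - int (vectorspace.dim K L)"
proof -
  interpret V: linear_action K L V act by fact
  interpret W: linear_action K L W act' by fact
  interpret DV: linear_action K L "dual K V" "dual_act K V act" by (rule V.dual_action)
  interpret DW: linear_action K L "dual K W" "dual_act K W act'" by (rule W.dual_action)
  let ?U = "direct_sum (dual K V) (dual K W)"
  let ?act = "direct_sum_act (dual K V) (dual K W) (dual_act K V act) (dual_act K W act')"
  interpret S: linear_action K L ?U ?act
    by (rule direct_sum_action[OF V.dual_action W.dual_action])
  obtain v0 where v0: "v0 \<in> carrier V" "\<And>x. \<lbrakk>x \<in> carrier L; act x v0 = \<zero>\<^bsub>V\<^esub>\<rbrakk> \<Longrightarrow> x = \<zero>\<^bsub>L\<^esub>"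
    using ind V.dual_index_minimal_iff by auto
  \<comment> \<open>Evaluation at \<open>v0\<close> on the first component, zero on the
    second.\<close>
  define \<Xi> where "\<Xi> = (\<lambda>(f, g)\<in>carrier ?U. f v0)"
  have \<Xi>: "\<Xi> \<in> carrier (dual K ?U)"
    unfolding \<Xi>_def using v0(1) DV.U.module.M.a_closed DW.U.module.M.a_closed
      DV.U.module.smult_closed DW.U.module.smult_closed
    by (intro dualI) (auto simp: dualD(2))
  have triv: "x = \<zero>\<^bsub>L\<^esub>" if x: "x \<in> carrier L" and 0: "dual_act K ?U ?act x \<Xi> = \<zero>\<^bsub>dual K ?U\<^esub>" for x
  proof -
    \<comment> \<open>Testing on the pair of \<open>f\<close> and zero reads off
      \<open>f (act x v0)\<close>, with two signs cancelling; all \<open>f\<close> together force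
      \<open>act x v0\<close> to vanish.\<close>
    have "f (act x v0) = f \<zero>\<^bsub>V\<^esub>" if f: "f \<in> carrier (dual K V)" for f
    proof -
      have mem: "(f, \<zero>\<^bsub>dual K W\<^esub>) \<in> carrier ?U"
        using f DW.U.module.M.zero_closed by simp
      have "\<ominus>\<^bsub>K\<^esub> \<Xi> (?act x (f, \<zero>\<^bsub>dual K W\<^esub>)) = \<zero>\<^bsub>K\<^esub>"
        using fun_cong[OF 0, of "(f, \<zero>\<^bsub>dual K W\<^esub>)"] mem by (simp add: dual_act_def del: W.U.dual_simps)
      moreover have "?act x (f, \<zero>\<^bsub>dual K W\<^esub>) = (dual_act K V act x f, dual_act K W act' x \<zero>\<^bsub>dual K W\<^esub>)"
        using mem by (simp del: W.U.dual_simps)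
      moreover have "(dual_act K V act x f, dual_act K W act' x \<zero>\<^bsub>dual K W\<^esub>) \<in> carrier ?U"
        using x f DW.U.module.M.zero_closed by (simp del: W.U.dual_simps)
      ultimately have "\<ominus>\<^bsub>K\<^esub> (dual_act K V act x f v0) = \<zero>\<^bsub>K\<^esub>"
        by (simp add: \<Xi>_def)
      then show ?thesis
        using x v0(1) dualD(2)[OF f] V.U.dual_zero[OF f] by (simp add: dual_act_def)
    qed
    then have "act x v0 = \<zero>\<^bsub>V\<^esub>"
      using V.U.dual_separates[OF V.fin_dim_U] x v0(1) by simp
    then show ?thesis by (rule v0(2)[OF x])
  qed
  have "lie_index K L ?U ?act = int S.U.dim - int V.L.dim"
    unfolding S.index_minimal_iff using \<Xi> triv by (intro bexI[of _ \<Xi>]) simp_all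
  moreover have "S.U.dim = V.U.dim + W.U.dim"
    using direct_sum_dim(2)[OF DV.U.vectorspace_axioms DW.U.vectorspace_axioms DV.fin_dim_U DW.fin_dim_U]
    by (simp add: V.U.dual_fin_dim(2)[OF V.fin_dim_U] W.U.dual_fin_dim(2)[OF W.fin_dim_U])
  ultimately show ?thesis by simp
qed

section \<open>Function algebras\<close>

lemma function_algebra_simps:
  "f \<in> carrier (function_algebra K P) \<longleftrightarrow> f \<in> extensional P \<and> (\<forall>x\<in>P. f x \<in> carrier K)"
  "\<zero>\<^bsub>function_algebra K P\<^esub> = (\<lambda>x\<in>P. \<zero>\<^bsub>K\<^esub>)"
  "\<one>\<^bsub>function_algebra K P\<^esub> = (\<lambda>x\<in>P. \<one>\<^bsub>K\<^esub>)"
  "f \<oplus>\<^bsub>function_algebra K P\<^esub> g = (\<lambda>x\<in>P. f x \<oplus>\<^bsub>K\<^esub> g x)"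
  "f \<otimes>\<^bsub>function_algebra K P\<^esub> g = (\<lambda>x\<in>P. f x \<otimes>\<^bsub>K\<^esub> g x)"
  "c \<odot>\<^bsub>function_algebra K P\<^esub> f = (\<lambda>x\<in>P. c \<otimes>\<^bsub>K\<^esub> f x)"
  if "ring K"
  using ring.func_space_simps[OF that] by (auto simp: function_algebra_def PiE_def)

lemma (in field) function_algebra_vectorspace: "vectorspace R (function_algebra R P)"
proof (rule vs_criteria)
  show "field R" ..
  show "\<forall>f\<in>carrier (function_algebra R P). \<exists>g\<in>carrier (function_algebra R P).
      f \<oplus>\<^bsub>function_algebra R P\<^esub> g = \<zero>\<^bsub>function_algebra R P\<^esub>"
  proof
    fix f assume "f \<in> carrier (function_algebra R P)"
    then show "\<exists>g\<in>carrier (function_algebra R P). f \<oplus>\<^bsub>function_algebra R P\<^esub> g = \<zero>\<^bsub>function_algebra R P\<^esub>"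
      by (intro bexI[of _ "\<lambda>x\<in>P. \<ominus> f x"])
        (auto simp: function_algebra_simps[OF is_ring] fun_eq_iff restrict_def extensional_def r_neg)
  qed
qed (auto simp: function_algebra_simps[OF is_ring] fun_eq_iff restrict_def extensional_def
    a_ac m_assoc l_distr r_distr)

text \<open>\<open>generate_ring\<close> closes under the negation of the record, which is given as
  an additive inverse; inductions over generated rings use this pointwise form.\<close>

lemma (in field) function_algebra_minus:
  assumes "f \<in> carrier (function_algebra R P)"
  shows "\<ominus>\<^bsub>function_algebra R P\<^esub> f = (\<lambda>x\<in>P. \<ominus> f x)"
proof -
  interpret F: vectorspace R "function_algebra R P" by (rule function_algebra_vectorspace)
  have "(\<lambda>x\<in>P. \<ominus> f x) \<oplus>\<^bsub>function_algebra R P\<^esub> f = \<zero>\<^bsub>function_algebra R P\<^esub>"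
    using assms by (simp add: function_algebra_simps[OF is_ring] fun_eq_iff restrict_def l_neg)
  moreover have "(\<lambda>x\<in>P. \<ominus> f x) \<in> carrier (function_algebra R P)"
    using assms by (auto simp: function_algebra_simps[OF is_ring])
  ultimately show ?thesis
    using assms by (intro F.module.M.minus_equality)
qed

lemma (in field) generate_function_algebra_closed:
  assumes "H \<subseteq> carrier (function_algebra R P)" "f \<in> generate_ring (function_algebra R P) H"
  shows "f \<in> carrier (function_algebra R P)"
  using assms(2)
proof (induction rule: generate_ring.induct)
  case (a_inv h)
  then have "(\<lambda>x\<in>P. \<ominus> h x) \<in> carrier (function_algebra R P)"
    by (simp add: function_algebra_simps(1)[OF is_ring])
  then show ?case by (simp only: function_algebra_minus[OF a_inv.IH])
next
  case (incl h)
  then show ?case using assms(1) by blast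
next
  case one
  have "(\<lambda>x\<in>P. \<one>) \<in> carrier (function_algebra R P)"
    by (simp add: function_algebra_simps(1)[OF is_ring])
  then show ?case by (simp only: function_algebra_simps(3)[OF is_ring])
qed (simp_all add: function_algebra_simps[OF is_ring] extensional_def)

section \<open>The coordinate ring of an affine variety\<close>

context affine_variety
begin

text \<open>The record that \<open>left_invariant_derivations\<close> and \<open>Lie\<close> build
  locally, named so that both can be folded to it.\<close>

definition coordinate_algebra where
  "coordinate_algebra = (function_algebra K P)\<lparr>carrier := A\<rparr>"

lemma A_generated:
  obtains F where "finite F" "F \<subseteq> A" "F \<subseteq> carrier (function_algebra K P)"
    "A = generate_ring (function_algebra K P) (constant_functions K P \<union> F)"
  using finitely_generated generate_ring.incl by (metis le_sup_iff subsetI)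

lemma generators_closed:
  assumes "F \<subseteq> carrier (function_algebra K P)"
  shows "constant_functions K P \<union> F \<subseteq> carrier (function_algebra K P)"
  using assms by (auto simp: constant_functions_def function_algebra_simps[OF K.is_ring])

lemma A_subset: "A \<subseteq> carrier (function_algebra K P)"
proof -
  obtain F where F: "F \<subseteq> carrier (function_algebra K P)"
    "A = generate_ring (function_algebra K P) (constant_functions K P \<union> F)"
    by (rule A_generated) (rule that)
  show ?thesis
    using K.generate_function_algebra_closed[OF generators_closed[OF F(1)]] F(2) by (metis subsetI)
qed

lemma A_eqI:
  assumes "f \<in> A" "g \<in> A" "\<And>x. x \<in> P \<Longrightarrow> f x = g x"
  shows "f = g"
  by (rule extensionalityI[of f P g])
    (use assms A_subset in \<open>simp_all add: function_algebra_simps[OF K.is_ring] subset_eq\<close>)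

lemma A_value [simp]: "\<lbrakk>f \<in> A; x \<in> P\<rbrakk> \<Longrightarrow> f x \<in> carrier K"
  using A_subset by (simp add: function_algebra_simps[OF K.is_ring] subset_eq)

lemma A_const [simp]: "c \<in> carrier K \<Longrightarrow> (\<lambda>x\<in>P. c) \<in> A"
  by (rule A_generated) (auto simp: constant_functions_def intro: generate_ring.incl)

lemma A_neg: "f \<in> A \<Longrightarrow> (\<lambda>x\<in>P. \<ominus>\<^bsub>K\<^esub> f x) \<in> A"
  using A_subset K.function_algebra_minus[of f P]
  by (metis A_generated generate_ring.a_inv subsetD)

lemma carrier_coordinate_algebra [simp]: "carrier coordinate_algebra = A"
  by (simp add: coordinate_algebra_def)

lemma coordinate_algebra_apply [simp]:
  assumes "x \<in> P"
  shows "\<zero>\<^bsub>coordinate_algebra\<^esub> x = \<zero>\<^bsub>K\<^esub>"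
    and "(f \<oplus>\<^bsub>coordinate_algebra\<^esub> g) x = f x \<oplus>\<^bsub>K\<^esub> g x"
    and "(f \<otimes>\<^bsub>coordinate_algebra\<^esub> g) x = f x \<otimes>\<^bsub>K\<^esub> g x"
    and "(c \<odot>\<^bsub>coordinate_algebra\<^esub> f) x = c \<otimes>\<^bsub>K\<^esub> f x"
  using assms by (simp_all add: coordinate_algebra_def function_algebra_simps[OF K.is_ring])

lemma A_add [simp]: "\<lbrakk>f \<in> A; g \<in> A\<rbrakk> \<Longrightarrow> f \<oplus>\<^bsub>coordinate_algebra\<^esub> g \<in> A"
  using A_generated generate_ring.eng_add[of f "function_algebra K P" _ g]
  by (simp add: coordinate_algebra_def) metis

lemma A_mult [simp]: "\<lbrakk>f \<in> A; g \<in> A\<rbrakk> \<Longrightarrow> f \<otimes>\<^bsub>coordinate_algebra\<^esub> g \<in> A"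
  using A_generated generate_ring.eng_mult[of f "function_algebra K P" _ g]
  by (simp add: coordinate_algebra_def) metis

lemma A_zero [simp]: "\<zero>\<^bsub>coordinate_algebra\<^esub> \<in> A"
  using A_const[of "\<zero>\<^bsub>K\<^esub>"] by (simp add: coordinate_algebra_def function_algebra_simps[OF K.is_ring])

text \<open>Reduces closure under scalars to closure under products, since the constant functions
  are among the generators.\<close>

lemma smult_eq_mult_const:
  "c \<odot>\<^bsub>coordinate_algebra\<^esub> f = (\<lambda>x\<in>P. c) \<otimes>\<^bsub>coordinate_algebra\<^esub> f"
  by (simp add: coordinate_algebra_def function_algebra_simps[OF K.is_ring] cong: restrict_cong)

lemma A_smult [simp]: "\<lbrakk>c \<in> carrier K; f \<in> A\<rbrakk> \<Longrightarrow> c \<odot>\<^bsub>coordinate_algebra\<^esub> f \<in> A"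
  by (simp add: smult_eq_mult_const)

lemma coordinate_algebra_vectorspace: "vectorspace K coordinate_algebra"
proof -
  interpret F: vectorspace K "function_algebra K P" by (rule K.function_algebra_vectorspace)
  have "VectorSpace.subspace K A (function_algebra K P)"
    by (rule F.subspaceI)
      (use A_subset A_zero A_add A_smult in \<open>simp_all add: coordinate_algebra_def\<close>)
  from F.subspace_is_vs[OF this] show ?thesis by (simp add: coordinate_algebra_def)
qed

lemma coordinate_algebra_minus:
  assumes "f \<in> A" "g \<in> A"
  shows "f \<ominus>\<^bsub>coordinate_algebra\<^esub> g \<in> A"
    and "x \<in> P \<Longrightarrow> (f \<ominus>\<^bsub>coordinate_algebra\<^esub> g) x = f x \<ominus>\<^bsub>K\<^esub> g x"
proof -
  interpret C: vectorspace K coordinate_algebra by (rule coordinate_algebra_vectorspace)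
  have "(\<lambda>x\<in>P. \<ominus>\<^bsub>K\<^esub> g x) \<oplus>\<^bsub>coordinate_algebra\<^esub> g = \<zero>\<^bsub>coordinate_algebra\<^esub>"
    by (rule A_eqI) (use assms A_neg in \<open>simp_all add: K.l_neg\<close>)
  then have "\<ominus>\<^bsub>coordinate_algebra\<^esub> g = (\<lambda>x\<in>P. \<ominus>\<^bsub>K\<^esub> g x)"
    using assms A_neg by (intro C.module.M.minus_equality) simp_all
  then show "f \<ominus>\<^bsub>coordinate_algebra\<^esub> g \<in> A"
    and "x \<in> P \<Longrightarrow> (f \<ominus>\<^bsub>coordinate_algebra\<^esub> g) x = f x \<ominus>\<^bsub>K\<^esub> g x"
    using assms A_neg by (simp_all add: a_minus_def)
qed

text \<open>The unit falls under the constants. Serves to spread the agreement of two derivations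
  from generators to all of \<open>A\<close>.\<close>

lemma generators_induct [consumes 3, case_names const gen neg add mult]:
  assumes F: "F \<subseteq> carrier (function_algebra K P)"
      "A = generate_ring (function_algebra K P) (constant_functions K P \<union> F)" and f: "f \<in> A"
    and "\<And>c. c \<in> carrier K \<Longrightarrow> Pr (\<lambda>x\<in>P. c)" "\<And>f. f \<in> F \<Longrightarrow> Pr f"
    and neg: "\<And>f. \<lbrakk>f \<in> A; Pr f\<rbrakk> \<Longrightarrow> Pr (\<lambda>x\<in>P. \<ominus>\<^bsub>K\<^esub> f x)"
    and "\<And>f g. \<lbrakk>f \<in> A; g \<in> A; Pr f; Pr g\<rbrakk> \<Longrightarrow> Pr (f \<oplus>\<^bsub>coordinate_algebra\<^esub> g)"
    and "\<And>f g. \<lbrakk>f \<in> A; g \<in> A; Pr f; Pr g\<rbrakk> \<Longrightarrow> Pr (f \<otimes>\<^bsub>coordinate_algebra\<^esub> g)"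
  shows "Pr f"
proof -
  have "f \<in> generate_ring (function_algebra K P) (constant_functions K P \<union> F)" using f F by simp
  then show ?thesis
  proof (induction rule: generate_ring.induct)
    case one
    show ?case unfolding function_algebra_simps(3)[OF K.is_ring] by (rule assms(4)) simp
  next
    case (incl h)
    then show ?case using assms(4,5) by (auto simp: constant_functions_def)
  next
    case (a_inv h)
    then have h: "h \<in> A" using F by simp
    show ?case
      using neg[OF h a_inv.IH] by (simp only: K.function_algebra_minus[OF subsetD[OF A_subset h]])
  next
    case (eng_add f g)
    then have "f \<in> A" "g \<in> A" using F by simp_all
    then show ?case using assms(7)[of f g] eng_add.IH by (simp add: coordinate_algebra_def)
  next
    case (eng_mult f g)
    then have "f \<in> A" "g \<in> A" using F by simp_all
    then show ?case using assms(8)[of f g] eng_mult.IH by (simp add: coordinate_algebra_def)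
  qed
qed

end

section \<open>The Lie algebra of an algebraic group\<close>

context algebraic_group
begin

text \<open>A generator from the first factor becomes a constant, one from the second is recovered
  unchanged, and slicing commutes with the ring operations. The first conjunct is carried along
  because the negation case needs the pointwise form of the negative.\<close>

lemma slice_in_A:
  assumes "h \<in> product_coordinate_ring K (carrier Q) A (carrier Q) A" "g \<in> carrier Q"
  shows "h \<in> carrier (function_algebra K (carrier Q \<times> carrier Q)) \<and> (\<lambda>y\<in>carrier Q. h (g, y)) \<in> A"
  using assms(1) unfolding product_coordinate_ring_def
proof (induction rule: generate_ring.induct)
  case one
  let ?one = "\<lambda>p\<in>carrier Q \<times> carrier Q. \<one>\<^bsub>K\<^esub>"
  have "?one \<in> carrier (function_algebra K (carrier Q \<times> carrier Q)) \<and>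
      (\<lambda>y\<in>carrier Q. ?one (g, y)) \<in> A"
    using assms(2) A_const[OF K.one_closed]
    by (simp add: function_algebra_simps(1)[OF K.is_ring] cong: restrict_cong)
  then show ?case by (simp only: function_algebra_simps(3)[OF K.is_ring])
next
  case (incl h)
  then consider f where "f \<in> A" "h = (\<lambda>(x, y)\<in>carrier Q \<times> carrier Q. f x)"
    | f where "f \<in> A" "h = (\<lambda>(x, y)\<in>carrier Q \<times> carrier Q. f y)"
    by blast
  then show ?case
  proof cases
    case (1 f)
    have "(\<lambda>y\<in>carrier Q. h (g, y)) = (\<lambda>y\<in>carrier Q. f g)"
      using 1 assms(2) by (intro restrict_ext) simp
    moreover have "h \<in> carrier (function_algebra K (carrier Q \<times> carrier Q))"
      using 1(1) unfolding 1(2) by (auto simp: function_algebra_simps(1)[OF K.is_ring])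
    ultimately show ?thesis
      using A_const[OF A_value[OF 1(1) assms(2)]] by (simp only: simp_thms)
  next
    case (2 f)
    have "(\<lambda>y\<in>carrier Q. h (g, y)) = (\<lambda>y\<in>carrier Q. f y)"
      using 2 assms(2) by (intro restrict_ext) simp
    moreover have "(\<lambda>y\<in>carrier Q. f y) = f"
      using 2 A_subset by (simp add: function_algebra_simps[OF K.is_ring] subset_eq extensional_restrict)
    moreover have "h \<in> carrier (function_algebra K (carrier Q \<times> carrier Q))"
      using 2(1) unfolding 2(2) by (auto simp: function_algebra_simps(1)[OF K.is_ring])
    ultimately show ?thesis using 2(1) by simp
  qed
next
  case (a_inv h)
  note h = conjunct1[OF a_inv.IH] conjunct2[OF a_inv.IH]
  let ?f = "\<lambda>p\<in>carrier Q \<times> carrier Q. \<ominus>\<^bsub>K\<^esub> h p"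
  have "?f \<in> carrier (function_algebra K (carrier Q \<times> carrier Q)) \<and> (\<lambda>y\<in>carrier Q. ?f (g, y)) \<in> A"
    using A_neg[OF h(2)] h(1) assms(2)
    by (auto simp: function_algebra_simps(1)[OF K.is_ring] cong: restrict_cong)
  then show ?case by (simp only: K.function_algebra_minus[OF h(1)])
next
  case (eng_add f h)
  note fh = conjunct1[OF eng_add.IH(1)] conjunct2[OF eng_add.IH(1)]
    conjunct1[OF eng_add.IH(2)] conjunct2[OF eng_add.IH(2)]
  let ?f = "\<lambda>p\<in>carrier Q \<times> carrier Q. f p \<oplus>\<^bsub>K\<^esub> h p"
  have "?f \<in> carrier (function_algebra K (carrier Q \<times> carrier Q)) \<and> (\<lambda>y\<in>carrier Q. ?f (g, y)) \<in> A"
    using A_add[OF fh(2,4)] fh(1,3) assms(2)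
    by (auto simp: function_algebra_simps(1,4)[OF K.is_ring] coordinate_algebra_def cong: restrict_cong)
  then show ?case by (simp only: function_algebra_simps(4)[OF K.is_ring])
next
  case (eng_mult f h)
  note fh = conjunct1[OF eng_mult.IH(1)] conjunct2[OF eng_mult.IH(1)]
    conjunct1[OF eng_mult.IH(2)] conjunct2[OF eng_mult.IH(2)]
  let ?f = "\<lambda>p\<in>carrier Q \<times> carrier Q. f p \<otimes>\<^bsub>K\<^esub> h p"
  have "?f \<in> carrier (function_algebra K (carrier Q \<times> carrier Q)) \<and> (\<lambda>y\<in>carrier Q. ?f (g, y)) \<in> A"
    using A_mult[OF fh(2,4)] fh(1,3) assms(2)
    by (auto simp: function_algebra_simps(1,5)[OF K.is_ring] coordinate_algebra_def cong: restrict_cong)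
  then show ?case by (simp only: function_algebra_simps(5)[OF K.is_ring])
qed

text \<open>The translate is the slice at the inverse of \<open>g\<close> of the regular function
  obtained by composing \<open>f\<close> with multiplication.\<close>

lemma left_translation_closed [simp]:
  assumes "g \<in> carrier Q" "f \<in> A"
  shows "left_translation Q g f \<in> A"
proof -
  have "(\<lambda>p\<in>carrier Q \<times> carrier Q. f ((\<lambda>(g, h). g \<otimes>\<^bsub>Q\<^esub> h) p))
      \<in> product_coordinate_ring K (carrier Q) A (carrier Q) A"
    using mult_regular assms(2) by (simp add: regular_maps_def)
  from slice_in_A[OF this Q.inv_closed[OF assms(1)]] show ?thesis
    using assms(1) by (simp add: left_translation_def cong: restrict_cong)
qed

lemma left_translation_apply [simp]:
  "x \<in> carrier Q \<Longrightarrow> left_translation Q g f x = f (inv\<^bsub>Q\<^esub> g \<otimes>\<^bsub>Q\<^esub> x)"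
  by (simp add: left_translation_def)

lemma Lie_mem_iff:
  "D \<in> carrier (Lie K Q A) \<longleftrightarrow> D \<in> extensional A \<and> (\<forall>f\<in>A. D f \<in> A) \<and>
    (\<forall>f\<in>A. \<forall>h\<in>A. D (f \<oplus>\<^bsub>coordinate_algebra\<^esub> h) = D f \<oplus>\<^bsub>coordinate_algebra\<^esub> D h) \<and>
    (\<forall>c\<in>carrier K. \<forall>f\<in>A. D (c \<odot>\<^bsub>coordinate_algebra\<^esub> f) = c \<odot>\<^bsub>coordinate_algebra\<^esub> D f) \<and>
    (\<forall>f\<in>A. \<forall>h\<in>A. D (f \<otimes>\<^bsub>coordinate_algebra\<^esub> h) =
      (D f \<otimes>\<^bsub>coordinate_algebra\<^esub> h) \<oplus>\<^bsub>coordinate_algebra\<^esub> (f \<otimes>\<^bsub>coordinate_algebra\<^esub> D h)) \<and>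
    (\<forall>g\<in>carrier Q. \<forall>f\<in>A. D (left_translation Q g f) = left_translation Q g (D f))"
  unfolding Lie_def left_invariant_derivations_def Let_def coordinate_algebra_def[symmetric]
    LinearCombinations.module_hom_def
  by auto

lemma Lie_ops:
  "\<zero>\<^bsub>Lie K Q A\<^esub> = (\<lambda>f\<in>A. \<zero>\<^bsub>coordinate_algebra\<^esub>)"
  "D \<oplus>\<^bsub>Lie K Q A\<^esub> E = (\<lambda>f\<in>A. D f \<oplus>\<^bsub>coordinate_algebra\<^esub> E f)"
  "c \<odot>\<^bsub>Lie K Q A\<^esub> D = (\<lambda>f\<in>A. c \<odot>\<^bsub>coordinate_algebra\<^esub> D f)"
  "D \<otimes>\<^bsub>Lie K Q A\<^esub> E = (\<lambda>f\<in>A. D (E f) \<ominus>\<^bsub>coordinate_algebra\<^esub> E (D f))"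
  by (simp_all add: Lie_def Let_def coordinate_algebra_def)

lemma LieD [simp]:
  assumes "D \<in> carrier (Lie K Q A)"
  shows "f \<in> A \<Longrightarrow> D f \<in> A"
    and "\<lbrakk>f \<in> A; h \<in> A\<rbrakk> \<Longrightarrow> D (f \<oplus>\<^bsub>coordinate_algebra\<^esub> h) = D f \<oplus>\<^bsub>coordinate_algebra\<^esub> D h"
    and "\<lbrakk>c \<in> carrier K; f \<in> A\<rbrakk> \<Longrightarrow> D (c \<odot>\<^bsub>coordinate_algebra\<^esub> f) = c \<odot>\<^bsub>coordinate_algebra\<^esub> D f"
    and "\<lbrakk>f \<in> A; h \<in> A\<rbrakk> \<Longrightarrow> D (f \<otimes>\<^bsub>coordinate_algebra\<^esub> h) =
      (D f \<otimes>\<^bsub>coordinate_algebra\<^esub> h) \<oplus>\<^bsub>coordinate_algebra\<^esub> (f \<otimes>\<^bsub>coordinate_algebra\<^esub> D h)"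
    and "\<lbrakk>g \<in> carrier Q; f \<in> A\<rbrakk> \<Longrightarrow> D (left_translation Q g f) = left_translation Q g (D f)"
  using assms unfolding Lie_mem_iff by blast+

lemma Lie_eqI:
  assumes "D \<in> carrier (Lie K Q A)" "E \<in> carrier (Lie K Q A)"
    and "\<And>f x. \<lbrakk>f \<in> A; x \<in> carrier Q\<rbrakk> \<Longrightarrow> D f x = E f x"
  shows "D = E"
proof (rule extensionalityI[of _ A])
  show "D \<in> extensional A" "E \<in> extensional A" using assms unfolding Lie_mem_iff by blast+
  show "D f = E f" if "f \<in> A" for f
    by (rule A_eqI) (use assms that in simp_all)
qed

lemma Lie_zero_closed: "\<zero>\<^bsub>Lie K Q A\<^esub> \<in> carrier (Lie K Q A)"
  unfolding Lie_mem_iff Lie_ops by (auto intro!: A_eqI)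

lemma Lie_add_closed:
  assumes "D \<in> carrier (Lie K Q A)" "E \<in> carrier (Lie K Q A)"
  shows "D \<oplus>\<^bsub>Lie K Q A\<^esub> E \<in> carrier (Lie K Q A)"
  unfolding Lie_mem_iff Lie_ops using assms
  by (auto intro!: A_eqI simp: K.l_distr K.r_distr K.a_ac)

lemma Lie_smult_closed:
  assumes "c \<in> carrier K" "D \<in> carrier (Lie K Q A)"
  shows "c \<odot>\<^bsub>Lie K Q A\<^esub> D \<in> carrier (Lie K Q A)"
  unfolding Lie_mem_iff Lie_ops using assms
  by (auto intro!: A_eqI simp: K.r_distr K.m_ac)

lemma Lie_bracket_closed:
  assumes "D \<in> carrier (Lie K Q A)" "E \<in> carrier (Lie K Q A)"
  shows "D \<otimes>\<^bsub>Lie K Q A\<^esub> E \<in> carrier (Lie K Q A)"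
proof -
  have add: "(a \<oplus>\<^bsub>K\<^esub> b) \<ominus>\<^bsub>K\<^esub> (c \<oplus>\<^bsub>K\<^esub> d) = (a \<ominus>\<^bsub>K\<^esub> c) \<oplus>\<^bsub>K\<^esub> (b \<ominus>\<^bsub>K\<^esub> d)"
    if "a \<in> carrier K" "b \<in> carrier K" "c \<in> carrier K" "d \<in> carrier K" for a b c d
    using that by (simp add: a_minus_def K.minus_add K.a_ac)
  have smult: "(r \<otimes>\<^bsub>K\<^esub> a) \<ominus>\<^bsub>K\<^esub> (r \<otimes>\<^bsub>K\<^esub> c) = r \<otimes>\<^bsub>K\<^esub> (a \<ominus>\<^bsub>K\<^esub> c)"
    if "r \<in> carrier K" "a \<in> carrier K" "c \<in> carrier K" for r a c
    using that by (simp add: a_minus_def K.r_minus K.r_distr)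
  \<comment> \<open>The product rule of the bracket at a point. The terms
    \<open>p \<otimes> q\<close> and \<open>r \<otimes> s\<close> are the mixed products
    \<open>E f \<otimes> D h\<close> and \<open>D f \<otimes> E h\<close>, each occurring once with
    either sign; the grouping is the one that \<open>add\<close> and \<open>smult\<close> leave
    behind.\<close>
  have leibniz: "a \<otimes>\<^bsub>K\<^esub> h \<ominus>\<^bsub>K\<^esub> c \<otimes>\<^bsub>K\<^esub> h \<oplus>\<^bsub>K\<^esub> (p \<otimes>\<^bsub>K\<^esub> q \<ominus>\<^bsub>K\<^esub> r \<otimes>\<^bsub>K\<^esub> s) \<oplus>\<^bsub>K\<^esub>
      (r \<otimes>\<^bsub>K\<^esub> s \<ominus>\<^bsub>K\<^esub> p \<otimes>\<^bsub>K\<^esub> q \<oplus>\<^bsub>K\<^esub> f \<otimes>\<^bsub>K\<^esub> (b \<ominus>\<^bsub>K\<^esub> d)) =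
      (a \<ominus>\<^bsub>K\<^esub> c) \<otimes>\<^bsub>K\<^esub> h \<oplus>\<^bsub>K\<^esub> f \<otimes>\<^bsub>K\<^esub> (b \<ominus>\<^bsub>K\<^esub> d)"
    if "a \<in> carrier K" "h \<in> carrier K" "p \<in> carrier K" "q \<in> carrier K" "r \<in> carrier K"
      "s \<in> carrier K" "f \<in> carrier K" "b \<in> carrier K" "c \<in> carrier K" "d \<in> carrier K"
    for a h p q r s f b c d
    using that by algebra
  show ?thesis
    unfolding Lie_mem_iff Lie_ops using assms
    by (auto intro!: A_eqI simp: coordinate_algebra_minus add smult leibniz)
qed

lemma Lie_vectorspace: "vectorspace K (Lie K Q A)"
proof (rule vs_criteria)
  show "field K" ..
  note [simp] = Lie_zero_closed Lie_add_closed Lie_smult_closed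
  show "\<forall>D\<in>carrier (Lie K Q A). \<exists>E\<in>carrier (Lie K Q A). D \<oplus>\<^bsub>Lie K Q A\<^esub> E = \<zero>\<^bsub>Lie K Q A\<^esub>"
  proof
    fix D assume D: "D \<in> carrier (Lie K Q A)"
    let ?E = "(\<ominus>\<^bsub>K\<^esub> \<one>\<^bsub>K\<^esub>) \<odot>\<^bsub>Lie K Q A\<^esub> D"
    have E: "?E \<in> carrier (Lie K Q A)" using D by simp
    have "D \<oplus>\<^bsub>Lie K Q A\<^esub> ?E = \<zero>\<^bsub>Lie K Q A\<^esub>"
    proof (rule Lie_eqI)
      show "D \<oplus>\<^bsub>Lie K Q A\<^esub> ?E \<in> carrier (Lie K Q A)" "\<zero>\<^bsub>Lie K Q A\<^esub> \<in> carrier (Lie K Q A)"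
        using D E by simp_all
      show "(D \<oplus>\<^bsub>Lie K Q A\<^esub> ?E) f x = \<zero>\<^bsub>Lie K Q A\<^esub> f x" if "f \<in> A" "x \<in> carrier Q" for f x
        using D that by (simp add: Lie_ops K.l_minus K.r_neg)
    qed
    then show "\<exists>E\<in>carrier (Lie K Q A). D \<oplus>\<^bsub>Lie K Q A\<^esub> E = \<zero>\<^bsub>Lie K Q A\<^esub>" using E by blast
  qed
qed (auto intro!: Lie_eqI simp: Lie_zero_closed Lie_add_closed Lie_smult_closed,
    auto simp: Lie_ops K.a_ac K.m_assoc K.l_distr K.r_distr)

text \<open>A left invariant derivation is determined by the tangent vector \<open>f \<mapsto> (D f)(1)\<close>, and the
  latter by its values on finitely many generators.\<close>

lemma derivation_at_unit:
  assumes "D \<in> carrier (Lie K Q A)" "f \<in> A" "g \<in> carrier Q"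
  shows "D f g = D (left_translation Q (inv\<^bsub>Q\<^esub> g) f) \<one>\<^bsub>Q\<^esub>"
  using assms by simp

lemma Lie_fin_dim: "vectorspace.fin_dim K (Lie K Q A)"
proof -
  interpret L: vectorspace K "Lie K Q A" by (rule Lie_vectorspace)
  obtain F where F: "finite F" "F \<subseteq> A" "F \<subseteq> carrier (function_algebra K (carrier Q))"
    "A = generate_ring (function_algebra K (carrier Q)) (constant_functions K (carrier Q) \<union> F)"
    by (rule A_generated) (rule that)
  interpret M: vectorspace K "K.func_space F" by (rule K.func_space_vectorspace)
  \<comment> \<open>The tangent vector of \<open>D\<close> at the identity, recorded on the
    generators.\<close>
  define T where "T D = (\<lambda>f\<in>F. D f \<one>\<^bsub>Q\<^esub>)" for D :: "('g \<Rightarrow> 'k) \<Rightarrow> 'g \<Rightarrow> 'k"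
  have FA: "f \<in> A" if "f \<in> F" for f using F(2) that by (rule subsetD)
  have hom: "T \<in> LinearCombinations.module_hom K (Lie K Q A) (K.func_space F)"
    by (rule module_homI)
      (auto simp: T_def Lie_ops FA K.func_space_simps fun_eq_iff restrict_def)
  interpret T: linear_map K "Lie K Q A" "K.func_space F" T
    by (rule linear_mapI[OF Lie_vectorspace K.func_space_vectorspace hom])
  have "D = E" if D: "D \<in> carrier (Lie K Q A)" and E: "E \<in> carrier (Lie K Q A)" and eq: "T D = T E" for D E
  proof (rule Lie_eqI[OF D E])
    \<comment> \<open>A derivation kills constants: \<open>1 = 1 * 1\<close> gives
      \<open>D' 1 = D' 1 + D' 1\<close> at the identity, and scalars factor out.\<close>
    have at_const: "D' (\<lambda>x\<in>carrier Q. c) \<one>\<^bsub>Q\<^esub> = \<zero>\<^bsub>K\<^esub>"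
      if D': "D' \<in> carrier (Lie K Q A)" and c: "c \<in> carrier K" for D' c
    proof -
      let ?one = "\<lambda>x\<in>carrier Q. \<one>\<^bsub>K\<^esub>"
      have one: "?one \<in> A" by simp
      have sq: "?one \<otimes>\<^bsub>coordinate_algebra\<^esub> ?one = ?one"
        by (rule A_eqI) simp_all
      have d: "D' ?one \<one>\<^bsub>Q\<^esub> \<in> carrier K" using D' one by simp
      have "D' ?one \<one>\<^bsub>Q\<^esub> = D' ?one \<one>\<^bsub>Q\<^esub> \<oplus>\<^bsub>K\<^esub> D' ?one \<one>\<^bsub>Q\<^esub>"
        using arg_cong[OF LieD(4)[OF D' one one], of "\<lambda>f. f \<one>\<^bsub>Q\<^esub>"] d by (simp add: sq)
      then have "D' ?one \<one>\<^bsub>Q\<^esub> = \<zero>\<^bsub>K\<^esub>" using d K.add.l_cancel_one' by metis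
      moreover have "(\<lambda>x\<in>carrier Q. c) = c \<odot>\<^bsub>coordinate_algebra\<^esub> ?one"
        by (rule A_eqI) (use c in simp_all)
      ultimately show ?thesis using D' c one by simp
    qed
    have unit: "D f \<one>\<^bsub>Q\<^esub> = E f \<one>\<^bsub>Q\<^esub>" if "f \<in> A" for f
      using F(3,4) that
    proof (induction rule: generators_induct)
      case (const c)
      have "D (\<lambda>x\<in>carrier Q. c) \<one>\<^bsub>Q\<^esub> = E (\<lambda>x\<in>carrier Q. c) \<one>\<^bsub>Q\<^esub>"
        by (simp only: at_const[OF D const] at_const[OF E const])
      then show ?case .
    next
      case (gen f)
      then show ?case using fun_cong[OF eq, of f] by (simp add: T_def)
    next
      case (neg f)
      have "(\<lambda>x\<in>carrier Q. \<ominus>\<^bsub>K\<^esub> f x) = (\<ominus>\<^bsub>K\<^esub> \<one>\<^bsub>K\<^esub>) \<odot>\<^bsub>coordinate_algebra\<^esub> f"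
        by (rule A_eqI) (use neg A_neg in \<open>simp_all add: K.l_minus\<close>)
      then show ?case using neg D E by simp
    qed (use D E in simp_all)
    \<comment> \<open>Left invariance carries the agreement from the identity to every
      point.\<close>
    show "D f x = E f x" if "f \<in> A" "x \<in> carrier Q" for f x
      unfolding derivation_at_unit[OF D that] derivation_at_unit[OF E that]
      by (rule unit) (use that in simp)
  qed
  then have "inj_on T (carrier (Lie K Q A))" by (intro inj_onI)
  then show ?thesis using T.inj_fin_dim K.func_space_fin_dim[OF F(1)] by simp
qed

end

section \<open>The differential of a rational module\<close>

context rational_module
begin

lemma rep_closed [simp]: "\<lbrakk>g \<in> carrier Q; v \<in> carrier V\<rbrakk> \<Longrightarrow> \<rho> g v \<in> carrier V"
  using module_hom_in_carrier[OF linear] .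

lemma matrix_coefficient_apply [simp]:
  "g \<in> carrier Q \<Longrightarrow> matrix_coefficient Q \<rho> l v g = l (\<rho> g v)"
  by (simp add: matrix_coefficient_def)

lemma matrix_coefficient_add:
  assumes "l \<in> carrier (dual K V)" "v \<in> carrier V" "w \<in> carrier V"
  shows "matrix_coefficient Q \<rho> l (v \<oplus>\<^bsub>V\<^esub> w) =
    matrix_coefficient Q \<rho> l v \<oplus>\<^bsub>coordinate_algebra\<^esub> matrix_coefficient Q \<rho> l w"
  by (rule A_eqI) (use assms in \<open>simp_all add: rational LinearCombinations.module_hom_add[OF linear] dualD\<close>)

lemma matrix_coefficient_smult:
  assumes "l \<in> carrier (dual K V)" "v \<in> carrier V" "c \<in> carrier K"
  shows "matrix_coefficient Q \<rho> l (c \<odot>\<^bsub>V\<^esub> v) = c \<odot>\<^bsub>coordinate_algebra\<^esub> matrix_coefficient Q \<rho> l v"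
  by (rule A_eqI) (use assms in \<open>simp_all add: rational LinearCombinations.module_hom_smult[OF linear] dualD\<close>)

lemma matrix_coefficient_dual_add:
  assumes "l \<in> carrier (dual K V)" "l' \<in> carrier (dual K V)" "v \<in> carrier V"
  shows "matrix_coefficient Q \<rho> (l \<oplus>\<^bsub>dual K V\<^esub> l') v =
    matrix_coefficient Q \<rho> l v \<oplus>\<^bsub>coordinate_algebra\<^esub> matrix_coefficient Q \<rho> l' v"
proof -
  interpret D: vectorspace K "dual K V" by (rule V.dual_vectorspace)
  show ?thesis
  proof (rule A_eqI)
    show "matrix_coefficient Q \<rho> (l \<oplus>\<^bsub>dual K V\<^esub> l') v \<in> A"
      by (intro rational D.module.M.a_closed assms)
  qed (use assms in \<open>simp_all add: rational\<close>)
qed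

lemma matrix_coefficient_dual_smult:
  assumes "l \<in> carrier (dual K V)" "c \<in> carrier K" "v \<in> carrier V"
  shows "matrix_coefficient Q \<rho> (c \<odot>\<^bsub>dual K V\<^esub> l) v =
    c \<odot>\<^bsub>coordinate_algebra\<^esub> matrix_coefficient Q \<rho> l v"
proof -
  interpret D: vectorspace K "dual K V" by (rule V.dual_vectorspace)
  show ?thesis
  proof (rule A_eqI)
    show "matrix_coefficient Q \<rho> (c \<odot>\<^bsub>dual K V\<^esub> l) v \<in> A"
      by (intro rational D.module.smult_closed assms)
  qed (use assms in \<open>simp_all add: rational\<close>)
qed

text \<open>The inverse cancels the one inside \<open>left_translation\<close>, leaving
  \<open>h \<mapsto> l (\<rho> (g h) v)\<close>, in which \<open>\<rho> g\<close> can be absorbed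
  into the functional.\<close>

lemma matrix_coefficient_translation:
  assumes "g \<in> carrier Q" "l \<in> carrier (dual K V)" "v \<in> carrier V"
  shows "left_translation Q (inv\<^bsub>Q\<^esub> g) (matrix_coefficient Q \<rho> l v) =
      matrix_coefficient Q \<rho> (\<lambda>w\<in>carrier V. l (\<rho> g w)) v"
    and "(\<lambda>w\<in>carrier V. l (\<rho> g w)) \<in> carrier (dual K V)"
proof -
  show "left_translation Q (inv\<^bsub>Q\<^esub> g) (matrix_coefficient Q \<rho> l v) =
      matrix_coefficient Q \<rho> (\<lambda>w\<in>carrier V. l (\<rho> g w)) v"
    unfolding left_translation_def matrix_coefficient_def
    by (rule restrict_ext) (use assms composition_rule in simp)
  show "(\<lambda>w\<in>carrier V. l (\<rho> g w)) \<in> carrier (dual K V)"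
    by (rule dualI) (use assms in \<open>simp_all add: dualD LinearCombinations.module_hom_add[OF linear]
        LinearCombinations.module_hom_smult[OF linear]\<close>)
qed

text \<open>The prescribed value is linear in \<open>l\<close>, hence an element of the bidual,
  hence evaluation at a vector, which is unique because functionals separate points. This gives the
  \<open>THE\<close> in \<open>differential\<close> its meaning.\<close>

lemma differential_ex1:
  assumes D: "D \<in> carrier (Lie K Q A)" and v: "v \<in> carrier V"
  shows "\<exists>!u. u \<in> carrier V \<and> (\<forall>l\<in>carrier (dual K V). l u = D (matrix_coefficient Q \<rho> l v) \<one>\<^bsub>Q\<^esub>)"
proof -
  interpret V': vectorspace K "dual K V" by (rule V.dual_vectorspace)
  have "(\<lambda>l\<in>carrier (dual K V). D (matrix_coefficient Q \<rho> l v) \<one>\<^bsub>Q\<^esub>) \<in> carrier (dual K (dual K V))"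
    by (rule dualI)
      (use D v in \<open>simp_all add: rational matrix_coefficient_dual_add matrix_coefficient_dual_smult
         V'.module.M.a_closed V'.module.smult_closed del: V.dual_simps\<close>)
  from V.bidual_evaluation[OF finite_dimensional this]
  obtain u where u: "u \<in> carrier V" "\<And>l. l \<in> carrier (dual K V) \<Longrightarrow>
      (\<lambda>l\<in>carrier (dual K V). D (matrix_coefficient Q \<rho> l v) \<one>\<^bsub>Q\<^esub>) l = l u"
    by metis
  show ?thesis
  proof (rule ex1I[of _ u])
    show "u \<in> carrier V \<and> (\<forall>l\<in>carrier (dual K V). l u = D (matrix_coefficient Q \<rho> l v) \<one>\<^bsub>Q\<^esub>)"
      using u by simp
    show "u' = u" if "u' \<in> carrier V \<and> (\<forall>l\<in>carrier (dual K V). l u' = D (matrix_coefficient Q \<rho> l v) \<one>\<^bsub>Q\<^esub>)" for u'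
      by (rule V.dual_separates[OF finite_dimensional]) (use u that in simp_all)
  qed
qed

lemma differential_closed [simp]:
  "\<lbrakk>D \<in> carrier (Lie K Q A); v \<in> carrier V\<rbrakk> \<Longrightarrow> differential K Q V \<rho> D v \<in> carrier V"
  using theI'[OF differential_ex1] by (simp add: differential_def)

lemma dual_differential:
  "\<lbrakk>D \<in> carrier (Lie K Q A); v \<in> carrier V; l \<in> carrier (dual K V)\<rbrakk> \<Longrightarrow>
    l (differential K Q V \<rho> D v) = D (matrix_coefficient Q \<rho> l v) \<one>\<^bsub>Q\<^esub>"
  using theI'[OF differential_ex1] by (simp add: differential_def)

lemma differential_eqI:
  assumes "D \<in> carrier (Lie K Q A)" "v \<in> carrier V" "u \<in> carrier V"
    and "\<And>l. l \<in> carrier (dual K V) \<Longrightarrow> D (matrix_coefficient Q \<rho> l v) \<one>\<^bsub>Q\<^esub> = l u"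
  shows "differential K Q V \<rho> D v = u"
  by (rule V.dual_separates[OF finite_dimensional])
    (use assms in \<open>simp_all add: dual_differential\<close>)

text \<open>Left invariance moves the value at \<open>g\<close> to the identity at the price of
  replacing \<open>l\<close> by \<open>l \<circ> \<rho> g\<close>. As the result is a coefficient
  again, derivations can be composed on coefficients, on which the bracket formula rests.\<close>

lemma derivation_matrix_coefficient:
  assumes "D \<in> carrier (Lie K Q A)" "l \<in> carrier (dual K V)" "v \<in> carrier V"
  shows "D (matrix_coefficient Q \<rho> l v) = matrix_coefficient Q \<rho> l (differential K Q V \<rho> D v)"
proof (rule A_eqI)
  fix g assume g: "g \<in> carrier Q"
  note t = matrix_coefficient_translation[OF g assms(2,3)]
  have "D (matrix_coefficient Q \<rho> l v) g =
      D (matrix_coefficient Q \<rho> (\<lambda>w\<in>carrier V. l (\<rho> g w)) v) \<one>\<^bsub>Q\<^esub>"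
    unfolding derivation_at_unit[OF assms(1) rational[OF assms(2,3)] g] t(1) ..
  also have "\<dots> = (\<lambda>w\<in>carrier V. l (\<rho> g w)) (differential K Q V \<rho> D v)"
    using dual_differential[OF assms(1,3) t(2)] by simp
  finally show "D (matrix_coefficient Q \<rho> l v) g =
      matrix_coefficient Q \<rho> l (differential K Q V \<rho> D v) g"
    using assms g by simp
qed (use assms in \<open>simp_all add: rational\<close>)

lemma differential_lie_action: "lie_action K (Lie K Q A) V (differential K Q V \<rho>)"
proof -
  interpret L: vectorspace K "Lie K Q A" by (rule Lie_vectorspace)
  show ?thesis
  proof
    show "L.fin_dim" by (rule Lie_fin_dim)
    show "V.fin_dim" by (rule finite_dimensional)
    show "(\<lambda>D. differential K Q V \<rho> D v) \<in> LinearCombinations.module_hom K (Lie K Q A) V"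
      if v: "v \<in> carrier V" for v
    proof (rule module_homI)
      show "differential K Q V \<rho> (D \<oplus>\<^bsub>Lie K Q A\<^esub> E) v =
          differential K Q V \<rho> D v \<oplus>\<^bsub>V\<^esub> differential K Q V \<rho> E v"
        if "D \<in> carrier (Lie K Q A)" "E \<in> carrier (Lie K Q A)" for D E
        by (rule differential_eqI)
          (use that v Lie_add_closed in \<open>simp_all add: Lie_ops(2) rational dualD(3) dual_differential\<close>)
      show "differential K Q V \<rho> (c \<odot>\<^bsub>Lie K Q A\<^esub> D) v = c \<odot>\<^bsub>V\<^esub> differential K Q V \<rho> D v"
        if "c \<in> carrier K" "D \<in> carrier (Lie K Q A)" for c D
        by (rule differential_eqI)
          (use that v Lie_smult_closed in \<open>simp_all add: Lie_ops(3) rational dualD(4) dual_differential\<close>)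
    qed (use v in simp)
    show "differential K Q V \<rho> D \<in> LinearCombinations.module_hom K V V"
      if D: "D \<in> carrier (Lie K Q A)" for D
    proof (rule module_homI)
      show "differential K Q V \<rho> D (v \<oplus>\<^bsub>V\<^esub> w) = differential K Q V \<rho> D v \<oplus>\<^bsub>V\<^esub> differential K Q V \<rho> D w"
        if "v \<in> carrier V" "w \<in> carrier V" for v w
        by (rule differential_eqI)
          (use that D in \<open>simp_all add: matrix_coefficient_add rational dualD(3) dual_differential\<close>)
      show "differential K Q V \<rho> D (c \<odot>\<^bsub>V\<^esub> v) = c \<odot>\<^bsub>V\<^esub> differential K Q V \<rho> D v"
        if "c \<in> carrier K" "v \<in> carrier V" for c v
        by (rule differential_eqI)
          (use that D in \<open>simp_all add: matrix_coefficient_smult rational dualD(4) dual_differential\<close>)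
    qed (use D in simp)
    show "D \<otimes>\<^bsub>Lie K Q A\<^esub> E \<in> carrier (Lie K Q A)"
      if "D \<in> carrier (Lie K Q A)" "E \<in> carrier (Lie K Q A)" for D E
      using Lie_bracket_closed[OF that] .
    show "differential K Q V \<rho> (D \<otimes>\<^bsub>Lie K Q A\<^esub> E) v =
        differential K Q V \<rho> D (differential K Q V \<rho> E v) \<ominus>\<^bsub>V\<^esub>
        differential K Q V \<rho> E (differential K Q V \<rho> D v)"
      if D: "D \<in> carrier (Lie K Q A)" and E: "E \<in> carrier (Lie K Q A)" and v: "v \<in> carrier V" for D E v
    proof (rule differential_eqI)
      show "D \<otimes>\<^bsub>Lie K Q A\<^esub> E \<in> carrier (Lie K Q A)" by (rule Lie_bracket_closed[OF D E])
      show "v \<in> carrier V" by fact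
      show "differential K Q V \<rho> D (differential K Q V \<rho> E v) \<ominus>\<^bsub>V\<^esub>
          differential K Q V \<rho> E (differential K Q V \<rho> D v) \<in> carrier V"
        using D E v by simp
      fix l assume l: "l \<in> carrier (dual K V)"
      have neg: "l (\<ominus>\<^bsub>V\<^esub> u) = \<ominus>\<^bsub>K\<^esub> l u" if u: "u \<in> carrier V" for u
      proof -
        have "l (\<ominus>\<^bsub>V\<^esub> u) \<oplus>\<^bsub>K\<^esub> l u = \<zero>\<^bsub>K\<^esub>"
          using dualD(3)[OF l, of "\<ominus>\<^bsub>V\<^esub> u" u] V.dual_zero[OF l] u by (simp add: V.module.M.l_neg)
        then show ?thesis using u dualD(2)[OF l] by (intro K.minus_equality[symmetric]) simp_all
      qed
      \<comment> \<open>The inner derivation moves onto the vector and the outer one is then read at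
        the identity, so \<open>D (E f)\<close> becomes \<open>D\<close> after \<open>E\<close> on
        \<open>V\<close>: the order is kept and no sign appears.\<close>
      show "(D \<otimes>\<^bsub>Lie K Q A\<^esub> E) (matrix_coefficient Q \<rho> l v) \<one>\<^bsub>Q\<^esub> =
          l (differential K Q V \<rho> D (differential K Q V \<rho> E v) \<ominus>\<^bsub>V\<^esub>
             differential K Q V \<rho> E (differential K Q V \<rho> D v))"
        using D E v l
        by (simp add: Lie_ops(4) rational coordinate_algebra_minus a_minus_def[of V] dualD(3)[OF l] neg
            dual_differential a_minus_def[of K])
          (simp add: derivation_matrix_coefficient)
    qed
  qed
qed

end

text \<open>A functional on the sum splits into functionals on the two summands, so each coefficient
  of the sum is a sum of coefficients. Both sides are restricted to pairs of vectors, hence equal as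
  functions once they agree there.\<close>

lemma differential_direct_sum:
  assumes "rational_module K Q A W \<sigma>" "rational_module K Q A V \<rho>" "D \<in> carrier (Lie K Q A)"
  shows "differential K Q (direct_sum W V) (direct_sum_act W V \<sigma> \<rho>) D =
    direct_sum_act W V (differential K Q W \<sigma>) (differential K Q V \<rho>) D"
proof -
  interpret W: rational_module K Q A W \<sigma> by fact
  interpret V: rational_module K Q A V \<rho> by fact
  interpret S: vectorspace K "direct_sum W V"
    by (rule direct_sum_is_vs[OF W.V.vectorspace_axioms V.V.vectorspace_axioms])
  have fd: "S.fin_dim"
    by (rule direct_sum_dim(1)[OF W.V.vectorspace_axioms V.V.vectorspace_axioms
          W.finite_dimensional V.finite_dimensional])
  have key: "D (matrix_coefficient Q (direct_sum_act W V \<sigma> \<rho>) l (w, v)) \<one>\<^bsub>Q\<^esub> =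
      l (differential K Q W \<sigma> D w, differential K Q V \<rho> D v)"
    if l: "l \<in> carrier (dual K (direct_sum W V))" and wv: "w \<in> carrier W" "v \<in> carrier V" for l w v
  proof -
    define l1 where "l1 = (\<lambda>w\<in>carrier W. l (w, \<zero>\<^bsub>V\<^esub>))"
    define l2 where "l2 = (\<lambda>v\<in>carrier V. l (\<zero>\<^bsub>W\<^esub>, v))"
    have split: "l (w, v) = l1 w \<oplus>\<^bsub>K\<^esub> l2 v" if "w \<in> carrier W" "v \<in> carrier V" for w v
      using dualD(3)[OF l, of "(w, \<zero>\<^bsub>V\<^esub>)" "(\<zero>\<^bsub>W\<^esub>, v)"] that by (simp add: l1_def l2_def)
    have l1: "l1 \<in> carrier (dual K W)"
    proof (rule dualI)
      show "l1 (w \<oplus>\<^bsub>W\<^esub> w') = l1 w \<oplus>\<^bsub>K\<^esub> l1 w'" if "w \<in> carrier W" "w' \<in> carrier W" for w w'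
        using dualD(3)[OF l, of "(w, \<zero>\<^bsub>V\<^esub>)" "(w', \<zero>\<^bsub>V\<^esub>)"] that by (simp add: l1_def)
      show "l1 (c \<odot>\<^bsub>W\<^esub> w) = c \<otimes>\<^bsub>K\<^esub> l1 w" if "c \<in> carrier K" "w \<in> carrier W" for c w
        using dualD(4)[OF l, of c "(w, \<zero>\<^bsub>V\<^esub>)"] that by (simp add: l1_def)
    qed (use dualD(2)[OF l] in \<open>simp_all add: l1_def\<close>)
    have l2: "l2 \<in> carrier (dual K V)"
    proof (rule dualI)
      show "l2 (v \<oplus>\<^bsub>V\<^esub> v') = l2 v \<oplus>\<^bsub>K\<^esub> l2 v'" if "v \<in> carrier V" "v' \<in> carrier V" for v v'
        using dualD(3)[OF l, of "(\<zero>\<^bsub>W\<^esub>, v)" "(\<zero>\<^bsub>W\<^esub>, v')"] that by (simp add: l2_def)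
      show "l2 (c \<odot>\<^bsub>V\<^esub> v) = c \<otimes>\<^bsub>K\<^esub> l2 v" if "c \<in> carrier K" "v \<in> carrier V" for c v
        using dualD(4)[OF l, of c "(\<zero>\<^bsub>W\<^esub>, v)"] that by (simp add: l2_def)
    qed (use dualD(2)[OF l] in \<open>simp_all add: l2_def\<close>)
    have "matrix_coefficient Q (direct_sum_act W V \<sigma> \<rho>) l (w, v) =
        matrix_coefficient Q \<sigma> l1 w \<oplus>\<^bsub>W.coordinate_algebra\<^esub> matrix_coefficient Q \<rho> l2 v"
      unfolding matrix_coefficient_def W.coordinate_algebra_def
      using wv by (simp add: function_algebra_simps(4)[OF W.K.is_ring] split cong: restrict_cong)
    then show ?thesis
      using assms(3) l1 l2 wv split
      by (simp add: W.rational V.rational W.dual_differential V.dual_differential)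
  qed
  have "differential K Q (direct_sum W V) (direct_sum_act W V \<sigma> \<rho>) D (w, v) =
      (differential K Q W \<sigma> D w, differential K Q V \<rho> D v)"
    if wv: "w \<in> carrier W" "v \<in> carrier V" for w v
  proof -
    have mem: "(differential K Q W \<sigma> D w, differential K Q V \<rho> D v) \<in> carrier (direct_sum W V)"
      using assms(3) wv by simp
    \<comment> \<open>Existence comes from \<open>key\<close>, uniqueness from the separation of
      points in the sum.\<close>
    have "(THE u. u \<in> carrier (direct_sum W V) \<and> (\<forall>l\<in>carrier (dual K (direct_sum W V)).
          l u = D (matrix_coefficient Q (direct_sum_act W V \<sigma> \<rho>) l (w, v)) \<one>\<^bsub>Q\<^esub>)) =
        (differential K Q W \<sigma> D w, differential K Q V \<rho> D v)"
    proof (rule the_equality)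
      show "u = (differential K Q W \<sigma> D w, differential K Q V \<rho> D v)"
        if "u \<in> carrier (direct_sum W V) \<and> (\<forall>l\<in>carrier (dual K (direct_sum W V)).
          l u = D (matrix_coefficient Q (direct_sum_act W V \<sigma> \<rho>) l (w, v)) \<one>\<^bsub>Q\<^esub>)" for u
        by (rule S.dual_separates[OF fd]) (use that mem key[OF _ wv] in \<open>simp_all del: direct_sum_simps\<close>)
    qed (use mem key[OF _ wv] in \<open>simp del: direct_sum_simps\<close>)
    then show ?thesis using wv by (simp add: differential_def)
  qed
  then show ?thesis
    by (intro extensionalityI[of _ "carrier W \<times> carrier V"])
      (auto simp: differential_def direct_sum_act_def)
qed

theorem theorem1p5:
  fixes K :: "('k, 'a) ring_scheme"
    and Q :: "('g, 'd) monoid_scheme" and A :: "('g \<Rightarrow> 'k) set"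
    and V :: "('k, 'v, 'b) module_scheme" and \<rho> :: "'g \<Rightarrow> 'v \<Rightarrow> 'v"
    and W :: "('k, 'w, 'c) module_scheme" and \<sigma> :: "'g \<Rightarrow> 'w \<Rightarrow> 'w"
  assumes "algebraically_closed K"
    and "\<And>n::nat. n > 0 \<Longrightarrow> [n] \<cdot>\<^bsub>K\<^esub> \<one>\<^bsub>K\<^esub> \<noteq> \<zero>\<^bsub>K\<^esub>"
    and "algebraic_group K Q A"
    and "rational_module K Q A V \<rho>"
    and "good_index_behaviour K Q A V \<rho>"
    and "lie_index K (Lie K Q A) (dual K V) (dual_act K V (differential K Q V \<rho>)) =
           int (vectorspace.dim K V) - int (vectorspace.dim K (Lie K Q A))"
    and "rational_module K Q A W \<sigma>"
  shows "good_index_behaviour K Q A (direct_sum W V) (direct_sum_act W V \<sigma> \<rho>) \<and>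
         lie_index K (Lie K Q A) (direct_sum (dual K V) (dual K W))
           (direct_sum_act (dual K V) (dual K W)
             (dual_act K V (differential K Q V \<rho>)) (dual_act K W (differential K Q W \<sigma>))) =
         int (vectorspace.dim K V) + int (vectorspace.dim K W) -
           int (vectorspace.dim K (Lie K Q A))"
proof
  interpret W: lie_action K "Lie K Q A" W "differential K Q W \<sigma>"
    by (rule rational_module.differential_lie_action) fact
  interpret V: lie_action K "Lie K Q A" V "differential K Q V \<rho>"
    by (rule rational_module.differential_lie_action) fact
  \<comment> \<open>The two actions are known to agree on elements of the Lie algebra, which is what
    the congruence rule asks for.\<close>
  have "lie_good_index_behaviour K (Lie K Q A) (direct_sum W V)
        (differential K Q (direct_sum W V) (direct_sum_act W V \<sigma> \<rho>)) \<longleftrightarrow>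
      lie_good_index_behaviour K (Lie K Q A) (direct_sum W V)
        (direct_sum_act W V (differential K Q W \<sigma>) (differential K Q V \<rho>))"
    by (rule lie_good_index_behaviour_cong) (rule differential_direct_sum[OF assms(7,4)])
  moreover have "lie_good_index_behaviour K (Lie K Q A) (direct_sum W V)
      (direct_sum_act W V (differential K Q W \<sigma>) (differential K Q V \<rho>))"
    using W.lie_action_axioms V.lie_action_axioms assms(5,6)
    by (intro direct_sum_good_index_behaviour) (simp_all add: good_index_behaviour_def)
  ultimately show "good_index_behaviour K Q A (direct_sum W V) (direct_sum_act W V \<sigma> \<rho>)"
    by (simp add: good_index_behaviour_def)
  show "lie_index K (Lie K Q A) (direct_sum (dual K V) (dual K W))
           (direct_sum_act (dual K V) (dual K W)
             (dual_act K V (differential K Q V \<rho>)) (dual_act K W (differential K Q W \<sigma>))) =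
         int (vectorspace.dim K V) + int (vectorspace.dim K W) -
           int (vectorspace.dim K (Lie K Q A))"
    by (rule direct_sum_dual_index[OF V.linear_action_axioms W.linear_action_axioms assms(6)])
qed

end
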